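(* Let $G$ be a VPT graph and let $h\geq 4$. Then $G\in[h,2,1]\setminus[h-1,2,1]$ if and only if $\max_{C\in\mathcal{C}(G)}\chi(B(G/C))=h$. Moreover, for $h=3$ the implication "if $\max_{C\in\mathcal{C}(G)}\chi(B(G/C))=3$ then $G\in[3,2,1]\setminus[2,2,1]$" also holds.
   Context: All graphs are finite, simple and connected. A clique is a maximal complete set of vertices; $\mathcal{C}(G)$ is the set of cliques of $G$; $\chi$ denotes chromatic number. An $(h,s,t)$-representation of a graph $G$ is a collection of subtrees $(T_v)_{v\in V(G)}$ of a tree $T$ such that (i) $T$ has maximum degree at most $h$, (ii) every $T_v$ has maximum degree at most $s$, and (iii) two distinct vertices $v,w$ are adjacent in $G$ iff $T_v$ and $T_w$ have at least $t$ vertices in common. $[h,s,t]$ is the class of graphs having an $(h,s,t)$-representation, with $\infty$ meaning no restriction; VPT $=[\infty,2,1]$. For a clique $C$ of $G$, the branch graph $B(G/C)$ has vertex set the vertices of $V(G)\setminus C$ adjacent to some vertex of $C$, and two such vertices $v,w$ are adjacent in $B(G/C)$ iff (1) $vw\notin E(G)$; (2) some vertex of $C$ is adjacent to both; and (3) there exist $v',w'\in C$ with $v'$ adjacent to $v$ but not to $w$, and $w'$ adjacent to $w$ but not to $v$. *)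

theory Defs
  imports Main "HOL-Library.Extended_Nat"
begin

definition connected_on :: "'a set \<Rightarrow> ('a \<Rightarrow> 'a \<Rightarrow> bool) \<Rightarrow> bool" where
  "connected_on V E \<longleftrightarrow>
     (\<forall>u\<in>V. \<forall>v\<in>V. (\<lambda>x y. x \<in> V \<and> y \<in> V \<and> E x y)\<^sup>*\<^sup>* u v)"

definition simple_graph :: "'a set \<Rightarrow> ('a \<Rightarrow> 'a \<Rightarrow> bool) \<Rightarrow> bool" where
  "simple_graph V E \<longleftrightarrow>
     (\<forall>x y. E x y \<longrightarrow> x \<in> V \<and> y \<in> V) \<and>
     (\<forall>x y. E x y \<longrightarrow> E y x) \<and>
     (\<forall>x. \<not> E x x)"

definition fsc_graph :: "'a set \<Rightarrow> ('a \<Rightarrow> 'a \<Rightarrow> bool) \<Rightarrow> bool" where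
  "fsc_graph V E \<longleftrightarrow> finite V \<and> V \<noteq> {} \<and> simple_graph V E \<and> connected_on V E"

definition complete_set :: "'a set \<Rightarrow> ('a \<Rightarrow> 'a \<Rightarrow> bool) \<Rightarrow> 'a set \<Rightarrow> bool" where
  "complete_set V E K \<longleftrightarrow> K \<subseteq> V \<and> (\<forall>x\<in>K. \<forall>y\<in>K. x \<noteq> y \<longrightarrow> E x y)"

definition is_clique :: "'a set \<Rightarrow> ('a \<Rightarrow> 'a \<Rightarrow> bool) \<Rightarrow> 'a set \<Rightarrow> bool" where
  "is_clique V E C \<longleftrightarrow> complete_set V E C \<and>
     (\<forall>K. complete_set V E K \<and> C \<subseteq> K \<longrightarrow> K = C)"

definition cliques :: "'a set \<Rightarrow> ('a \<Rightarrow> 'a \<Rightarrow> bool) \<Rightarrow> 'a set set" where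
  "cliques V E = {C. is_clique V E C}"

definition proper_colouring :: "'a set \<Rightarrow> ('a \<Rightarrow> 'a \<Rightarrow> bool) \<Rightarrow> ('a \<Rightarrow> nat) \<Rightarrow> nat \<Rightarrow> bool" where
  "proper_colouring V E f k \<longleftrightarrow>
     (\<forall>x\<in>V. f x < k) \<and> (\<forall>x\<in>V. \<forall>y\<in>V. E x y \<longrightarrow> f x \<noteq> f y)"

definition chromatic_number :: "'a set \<Rightarrow> ('a \<Rightarrow> 'a \<Rightarrow> bool) \<Rightarrow> nat" where
  "chromatic_number V E = (LEAST k. \<exists>f. proper_colouring V E f k)"

definition branch_vertices :: "'a set \<Rightarrow> ('a \<Rightarrow> 'a \<Rightarrow> bool) \<Rightarrow> 'a set \<Rightarrow> 'a set" where
  "branch_vertices V E C = {v \<in> V - C. \<exists>c\<in>C. E v c}"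

definition branch_edge :: "'a set \<Rightarrow> ('a \<Rightarrow> 'a \<Rightarrow> bool) \<Rightarrow> 'a set \<Rightarrow> 'a \<Rightarrow> 'a \<Rightarrow> bool" where
  "branch_edge V E C v w \<longleftrightarrow>
     v \<in> branch_vertices V E C \<and> w \<in> branch_vertices V E C \<and> v \<noteq> w \<and>
     \<not> E v w \<and>
     (\<exists>c\<in>C. E c v \<and> E c w) \<and>
     (\<exists>v'\<in>C. \<exists>w'\<in>C. E v' v \<and> \<not> E v' w \<and> E w' w \<and> \<not> E w' v)"

definition max_branch_chi :: "'a set \<Rightarrow> ('a \<Rightarrow> 'a \<Rightarrow> bool) \<Rightarrow> nat" where
  "max_branch_chi V E =
     Max ((\<lambda>C. chromatic_number (branch_vertices V E C) (branch_edge V E C)) ` cliques V E)"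

definition cycle_in :: "'b set \<Rightarrow> ('b \<Rightarrow> 'b \<Rightarrow> bool) \<Rightarrow> 'b list \<Rightarrow> bool" where
  "cycle_in VT ET xs \<longleftrightarrow> length xs \<ge> 3 \<and> distinct xs \<and> set xs \<subseteq> VT \<and>
     (\<forall>i. Suc i < length xs \<longrightarrow> ET (xs ! i) (xs ! Suc i)) \<and>
     ET (last xs) (hd xs)"

definition is_tree :: "'b set \<Rightarrow> ('b \<Rightarrow> 'b \<Rightarrow> bool) \<Rightarrow> bool" where
  "is_tree VT ET \<longleftrightarrow> fsc_graph VT ET \<and> (\<nexists>xs. cycle_in VT ET xs)"

definition is_subtree :: "'b set \<Rightarrow> ('b \<Rightarrow> 'b \<Rightarrow> bool) \<Rightarrow> 'b set \<Rightarrow> bool" where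
  "is_subtree VT ET S \<longleftrightarrow> S \<noteq> {} \<and> S \<subseteq> VT \<and> connected_on S ET"

definition deg_in :: "'b set \<Rightarrow> ('b \<Rightarrow> 'b \<Rightarrow> bool) \<Rightarrow> 'b \<Rightarrow> nat" where
  "deg_in S ET x = card {y \<in> S. ET x y}"

definition max_deg_le :: "'b set \<Rightarrow> ('b \<Rightarrow> 'b \<Rightarrow> bool) \<Rightarrow> enat \<Rightarrow> bool" where
  "max_deg_le S ET d \<longleftrightarrow> (\<forall>x\<in>S. enat (deg_in S ET x) \<le> d)"

text \<open>(h,s,t)-representation with host tree on vertices of type nat
  (every finite tree is isomorphic to one on natural numbers);
  \<infinity> means no restriction.\<close>
definition hst_representation ::
  "'a set \<Rightarrow> ('a \<Rightarrow> 'a \<Rightarrow> bool) \<Rightarrow> enat \<Rightarrow> enat \<Rightarrow> nat \<Rightarrow>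
   nat set \<Rightarrow> (nat \<Rightarrow> nat \<Rightarrow> bool) \<Rightarrow> ('a \<Rightarrow> nat set) \<Rightarrow> bool" where
  "hst_representation V E h s t VT ET Tv \<longleftrightarrow>
     is_tree VT ET \<and> max_deg_le VT ET h \<and>
     (\<forall>v\<in>V. is_subtree VT ET (Tv v) \<and> max_deg_le (Tv v) ET s) \<and>
     (\<forall>v\<in>V. \<forall>w\<in>V. v \<noteq> w \<longrightarrow> (E v w \<longleftrightarrow> card (Tv v \<inter> Tv w) \<ge> t))"

definition in_class :: "'a set \<Rightarrow> ('a \<Rightarrow> 'a \<Rightarrow> bool) \<Rightarrow> enat \<Rightarrow> enat \<Rightarrow> nat \<Rightarrow> bool" where
  "in_class V E h s t \<longleftrightarrow> (\<exists>VT ET Tv. hst_representation V E h s t VT ET Tv)"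

definition VPT :: "'a set \<Rightarrow> ('a \<Rightarrow> 'a \<Rightarrow> bool) \<Rightarrow> bool" where
  "VPT V E \<longleftrightarrow> in_class V E \<infinity> 2 1"

end

theory Submission
  imports Defs
begin

text \<open>
  For \<open>h \<ge> 3\<close> a VPT graph is in \<open>[h,2,1]\<close> iff every branch graph is \<open>h\<close>-colourable; the
  forward implication holds for every \<open>h\<close>.

  Forward: root the host tree at a vertex \<open>q\<close> lying on exactly the paths of the clique \<open>C\<close>
  (Helly property) and colour each branch vertex by the component of \<open>T - q\<close> containing its path.
  A vertex of \<open>C\<close> is adjacent to \<open>v\<close> iff its path contains the vertex of the path of \<open>v\<close> nearest
  to \<open>q\<close>, so two branch vertices in the same component with a common neighbour in \<open>C\<close> have
  nested neighbourhoods in \<open>C\<close>.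

  Backward: in a representation with the fewest host vertices no edge \<open>qy\<close> can be contracted, so
  the paths through \<open>q\<close> form a clique and every neighbour \<open>y\<close> of \<open>q\<close> lies on a path avoiding
  \<open>q\<close>. An \<open>h\<close>-colouring of the branch graph then yields an \<open>h\<close>-colouring of the neighbours of
  \<open>q\<close> in which the two neighbours used by a path through \<open>q\<close> always differ. As long as \<open>q\<close> has
  more than \<open>h\<close> neighbours, two of them share a colour; they can be moved to a new vertex of degree
  3 attached to \<open>q\<close>, which lowers the degree of \<open>q\<close> and keeps all colourings.
\<close>

section \<open>Rooted trees\<close>

text \<open>The rank \<open>d\<close> only has to drop strictly towards the parent. This is enough
  for connectedness and acyclicity, and unlike exact depth it survives contracting an edge or
  inserting a vertex.\<close>

locale ranked_tree =
  fixes VT :: "'b set" and ET :: "'b \<Rightarrow> 'b \<Rightarrow> bool" and r :: 'b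
    and p :: "'b \<Rightarrow> 'b" and d :: "'b \<Rightarrow> nat"
  assumes finite_VT: "finite VT"
    and root_in: "r \<in> VT"
    and parent_in: "x \<in> VT \<Longrightarrow> x \<noteq> r \<Longrightarrow> p x \<in> VT"
    and rank_parent: "x \<in> VT \<Longrightarrow> x \<noteq> r \<Longrightarrow> d (p x) < d x"
    and edge_iff: "ET x y \<longleftrightarrow> x \<in> VT \<and> y \<in> VT \<and> (x \<noteq> r \<and> y = p x \<or> y \<noteq> r \<and> x = p y)"
begin

text \<open>A subtree described by its vertex nearest the root and closure under parents. Inclusions
  in such sets are checked by following parents, with no walks involved.\<close>

definition topped :: "'b set \<Rightarrow> 'b \<Rightarrow> bool" where
  "topped S t \<longleftrightarrow> S \<subseteq> VT \<and> t \<in> S \<and> (\<forall>x\<in>S. x \<noteq> t \<longrightarrow> x \<noteq> r \<and> p x \<in> S)"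

lemma edge_sym: "ET x y \<Longrightarrow> ET y x"
  unfolding edge_iff by auto

lemma edge_irrefl: "\<not> ET x x"
  unfolding edge_iff using rank_parent by fastforce

lemma edge_parent: "x \<in> VT \<Longrightarrow> x \<noteq> r \<Longrightarrow> ET x (p x)"
  unfolding edge_iff using parent_in by auto

lemma topped_connected:
  assumes "topped S t"
  shows "connected_on S ET"
proof -
  let ?R = "\<lambda>x y. x \<in> S \<and> y \<in> S \<and> ET x y"
  have S: "S \<subseteq> VT" "t \<in> S" "\<And>x. x \<in> S \<Longrightarrow> x \<noteq> t \<Longrightarrow> x \<noteq> r \<and> p x \<in> S"
    using assms unfolding topped_def by auto
  have to_top: "?R\<^sup>*\<^sup>* x t" if "x \<in> S" for x
    using that
  proof (induction "d x" arbitrary: x rule: less_induct)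
    case less
    show ?case
    proof (cases "x = t")
      case False
      then have "x \<noteq> r" "p x \<in> S" using S(3) less.prems by auto
      moreover have "x \<in> VT" using S(1) less.prems by auto
      ultimately have "?R x (p x)" "?R\<^sup>*\<^sup>* (p x) t"
        using less.prems edge_parent[of x] less.hyps[of "p x"] rank_parent[of x] by blast+
      then show ?thesis by (rule converse_rtranclp_into_rtranclp)
    qed simp
  qed
  have "symp ?R" using edge_sym by (auto simp: symp_def)
  then have "symp ?R\<^sup>*\<^sup>*" by (rule symp_rtranclp)
  then have from_top: "?R\<^sup>*\<^sup>* t x" if "x \<in> S" for x
    using to_top[OF that] by (rule sympD)
  show ?thesis
    unfolding connected_on_def
    using rtranclp_trans[OF to_top from_top] by blast
qed

text \<open>A vertex of maximal rank on a cycle can only be joined to the rest of the cycle through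
  its parent, so its two distinct cycle neighbours would coincide.\<close>

lemma no_cycle: "\<not> cycle_in VT ET xs"
proof
  assume cyc: "cycle_in VT ET xs"
  let ?n = "length xs"
  have n: "?n \<ge> 3" and dist: "distinct xs" and sub: "set xs \<subseteq> VT"
    and step: "\<And>i. Suc i < ?n \<Longrightarrow> ET (xs ! i) (xs ! Suc i)" and close: "ET (last xs) (hd xs)"
    using cyc unfolding cycle_in_def by auto
  have "Max (d ` set xs) \<in> d ` set xs" using n by (intro Max_in) auto
  then obtain x where x: "x \<in> set xs" "d x = Max (d ` set xs)" by auto
  then have top: "d y \<le> d x" if "y \<in> set xs" for y using that by auto
  have to_parent: "y = p x" if "ET x y" "y \<in> set xs" for y
    using that rank_parent[of y] top[of y] unfolding edge_iff by auto
  obtain i where i: "i < ?n" "x = xs ! i" using x by (metis in_set_conv_nth)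
  have ne: "xs \<noteq> []" using n by auto
  have wrap: "ET (xs ! (?n - 1)) (xs ! 0)" using close ne by (simp add: last_conv_nth hd_conv_nth)
  \<comment> \<open>\<open>j\<close> and \<open>k\<close> are the cyclic successor and predecessor
    of position \<open>i\<close>; they differ because the cycle has at least three vertices.\<close>
  define j where "j = (if Suc i < ?n then Suc i else 0)"
  define k where "k = (if i = 0 then ?n - 1 else i - 1)"
  have jk: "j < ?n" "k < ?n" "j \<noteq> k" using n i unfolding j_def k_def by auto
  have "ET x (xs ! j)"
  proof (cases "Suc i < ?n")
    case False
    then have "i = ?n - 1" using i by simp
    then show ?thesis using wrap i False unfolding j_def by auto
  qed (auto simp: j_def i step)
  moreover have "ET (xs ! k) x"
    using wrap i step[of "i - 1"] unfolding k_def by auto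
  ultimately have "xs ! j = p x" "xs ! k = p x"
    using to_parent jk edge_sym nth_mem by blast+
  then show False using jk dist by (metis nth_eq_iff_index_eq)
qed

lemma is_tree: "is_tree VT ET"
proof -
  obtain t where "topped VT t"
    unfolding topped_def using root_in parent_in by blast
  then have "connected_on VT ET" by (rule topped_connected)
  moreover have "simple_graph VT ET"
    unfolding simple_graph_def using edge_sym edge_irrefl edge_iff by blast
  ultimately show ?thesis
    unfolding is_tree_def fsc_graph_def using finite_VT root_in no_cycle by blast
qed

end

locale rooted_tree = ranked_tree VT ET r p d
  for VT :: "'b set" and ET r p d +
  assumes depth_root: "d r = 0"
    and depth_parent: "x \<in> VT \<Longrightarrow> x \<noteq> r \<Longrightarrow> d x = Suc (d (p x))"
begin

text \<open>The ancestor of \<open>x\<close> at depth \<open>n\<close>. Truncated subtraction makes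
  it \<open>x\<close> itself when \<open>n\<close> is at least the depth of
  \<open>x\<close>.\<close>

definition up :: "'b \<Rightarrow> nat \<Rightarrow> 'b" where
  "up x n = (p ^^ (d x - n)) x"

lemma up_self: "d x \<le> n \<Longrightarrow> up x n = x"
  unfolding up_def by simp

lemma up_parent:
  assumes "x \<in> VT" "x \<noteq> r" "n < d x"
  shows "up x n = up (p x) n"
proof -
  have "d x - n = Suc (d (p x) - n)" using depth_parent[OF assms(1,2)] assms(3) by simp
  then show ?thesis unfolding up_def by (simp add: funpow_swap1)
qed

lemma depth_0: "x \<in> VT \<Longrightarrow> d x = 0 \<Longrightarrow> x = r"
  using depth_parent by fastforce

lemma up_in: "x \<in> VT \<Longrightarrow> up x n \<in> VT \<and> d (up x n) = min n (d x)"
proof (induction "d x" arbitrary: x rule: less_induct)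
  case less
  show ?case
  proof (cases "d x \<le> n")
    case False
    then have "x \<noteq> r" using depth_root by auto
    then show ?thesis
      using less False up_parent[of x n] rank_parent[of x] parent_in[of x] depth_parent[of x] by auto
  qed (use less in \<open>auto simp: up_self\<close>)
qed

lemma up_Suc:
  assumes "x \<in> VT" "n < d x"
  shows "up x n = p (up x (Suc n))"
proof -
  have "d x - n = Suc (d x - Suc n)" using assms by simp
  then show ?thesis unfolding up_def by simp
qed

lemma topped_up:
  assumes "topped S t" "x \<in> S"
  shows "d t \<le> d x \<and> up x (d t) = t \<and> (\<forall>n\<ge>d t. up x n \<in> S)"
  using assms(2)
proof (induction "d x" arbitrary: x rule: less_induct)
  case less
  show ?case
  proof (cases "x = t")
    case True
    then show ?thesis using up_self less.prems by auto
  next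
    case False
    have x: "x \<in> VT" "x \<noteq> r" "p x \<in> S"
      using assms(1) less.prems False unfolding topped_def by auto
    then have IH: "d t \<le> d (p x)" "up (p x) (d t) = t" "\<forall>n\<ge>d t. up (p x) n \<in> S"
      using less.hyps[of "p x"] rank_parent by auto
    have "up x n \<in> S" if "d t \<le> n" for n
      using that IH up_parent[OF x(1,2)] up_self less.prems by (cases "n < d x") auto
    then show ?thesis using IH x up_parent[OF x(1,2)] depth_parent[of x] by auto
  qed
qed

lemma connected_topped:
  assumes S: "S \<subseteq> VT" "S \<noteq> {}" and con: "connected_on S ET"
  obtains t where "topped S t"
proof -
  obtain t where t: "t \<in> S" "\<And>x. x \<in> S \<Longrightarrow> d t \<le> d x"
    using S(2) ex_has_least_nat[of "\<lambda>x. x \<in> S" _ d] by blast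
  have "x \<noteq> r \<and> p x \<in> S" if x: "x \<in> S" "x \<noteq> t" for x
  proof
    show "x \<noteq> r" using x t depth_root depth_0 S(1) by (metis le_zero_eq subsetD)
    let ?R = "\<lambda>x y. x \<in> S \<and> y \<in> S \<and> ET x y"
    \<comment> \<open>\<open>D\<close> consists of \<open>x\<close> and its descendants. A walk in
      \<open>S\<close> from \<open>x\<close> to the shallower \<open>t\<close> has to leave
      \<open>D\<close>, and the only edge out of \<open>D\<close> leads from \<open>x\<close> to
      \<open>p x\<close>.\<close>
    define D where "D = {a \<in> VT. d x \<le> d a \<and> up a (d x) = x}"
    have "?R\<^sup>*\<^sup>* x t" using con x t unfolding connected_on_def by blast
    then have "t \<in> D \<or> p x \<in> S"
    proof induction
      case base
      then show ?case using x S(1) by (auto simp: D_def up_self)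
    next
      case (step y z)
      then have e: "y \<in> VT" "z \<in> VT" "z \<in> S" "y \<noteq> r \<and> z = p y \<or> z \<noteq> r \<and> y = p z"
        unfolding edge_iff by auto
      show ?case
      proof (cases "p x \<in> S")
        case False
        then have y: "y \<in> D" using step.IH by auto
        from e(4) show ?thesis
        proof
          assume z: "y \<noteq> r \<and> z = p y"
          then have "y \<noteq> x" using False e by auto
          then have "d x < d y" using y up_self[of y "d x"] unfolding D_def by force
          then show ?thesis
            using y z e up_parent[of y "d x"] depth_parent[of y] unfolding D_def by auto
        next
          assume z: "z \<noteq> r \<and> y = p z"
          then show ?thesis
            using y e up_parent[of z "d x"] depth_parent[of z] unfolding D_def by auto
        qed
      qed simp
    qed
    moreover have "t \<notin> D" using t x up_self unfolding D_def by force
    ultimately show "p x \<in> S" by simp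
  qed
  then show ?thesis using that t S(1) unfolding topped_def by blast
qed

lemma topped_root: "topped S t \<Longrightarrow> r \<in> S \<Longrightarrow> t = r"
  unfolding topped_def by auto

text \<open>The deepest top lies in every set: a vertex common to \<open>S i\<close> and
  \<open>S j\<close> has both tops as ancestors, and \<open>S j\<close> contains its whole chain of
  ancestors down from \<open>t j\<close>, hence also \<open>t i\<close>.\<close>

lemma helly:
  assumes I: "finite I" "I \<noteq> {}" and top: "\<And>i. i \<in> I \<Longrightarrow> topped (S i) (t i)"
    and meet: "\<And>i j. i \<in> I \<Longrightarrow> j \<in> I \<Longrightarrow> S i \<inter> S j \<noteq> {}"
  shows "\<exists>q\<in>VT. \<forall>i\<in>I. q \<in> S i"
proof -
  have "Max ((d \<circ> t) ` I) \<in> (d \<circ> t) ` I" using I by (intro Max_in) auto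
  then obtain i where i: "i \<in> I" "d (t i) = Max ((d \<circ> t) ` I)" by auto
  then have deepest: "d (t j) \<le> d (t i)" if "j \<in> I" for j using that I(1) by auto
  have "t i \<in> S j" if j: "j \<in> I" for j
  proof -
    obtain x where x: "x \<in> S i" "x \<in> S j" using meet i j by blast
    then show ?thesis
      using topped_up[OF top[OF i(1)] x(1)] topped_up[OF top[OF j] x(2)] deepest[OF j] by metis
  qed
  then show ?thesis using i top[OF i(1)] unfolding topped_def by blast
qed

end

section \<open>Leaves and rooting of finite trees\<close>

lemma tree_leaf:
  assumes tree: "is_tree VT ET" and r: "r \<in> VT" and ne: "VT \<noteq> {r}"
  obtains l m where "l \<in> VT" "l \<noteq> r" "m \<in> VT" "m \<noteq> l" "\<And>y. ET l y \<longleftrightarrow> y = m"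
proof -
  have fin: "finite VT" and sim: "simple_graph VT ET" and con: "connected_on VT ET"
    and acyc: "\<And>xs. \<not> cycle_in VT ET xs"
    using tree unfolding is_tree_def fsc_graph_def by auto
  have sym: "ET x y \<Longrightarrow> ET y x" and irr: "\<not> ET x x" and inV: "ET x y \<Longrightarrow> x \<in> VT \<and> y \<in> VT" for x y
    using sim unfolding simple_graph_def by auto
  \<comment> \<open>\<open>P\<close> describes the paths starting at \<open>r\<close>. The leaf is
    the end of a longest one, since all its neighbours must already lie on that path.\<close>
  define P where "P xs \<longleftrightarrow> xs \<noteq> [] \<and> hd xs = r \<and> distinct xs \<and> set xs \<subseteq> VT \<and>
    (\<forall>i. Suc i < length xs \<longrightarrow> ET (xs ! i) (xs ! Suc i))" for xs
  have "P [r]" using r unfolding P_def by auto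
  moreover have "length xs < Suc (card VT)" if "P xs" for xs
    using that fin card_mono[of VT "set xs"] distinct_card[of xs] unfolding P_def by auto
  ultimately obtain xs where xs: "P xs" and longest: "\<And>ys. P ys \<Longrightarrow> length ys \<le> length xs"
    using ex_has_greatest_nat[of P "[r]" length "Suc (card VT)"] by blast
  let ?n = "length xs"
  define l where "l = last xs"
  have p: "xs \<noteq> []" "hd xs = r" "distinct xs" "set xs \<subseteq> VT"
    "\<And>i. Suc i < ?n \<Longrightarrow> ET (xs ! i) (xs ! Suc i)"
    using xs unfolding P_def by auto
  have l: "l \<in> VT" "l = xs ! (?n - 1)" using p unfolding l_def by (auto simp: last_conv_nth)
  have on: "y \<in> set xs" if "ET l y" for y
  proof (rule ccontr)
    assume y: "y \<notin> set xs"
    have "P (xs @ [y])"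
      unfolding P_def
    proof (intro conjI allI impI)
      fix i assume i: "Suc i < length (xs @ [y])"
      show "ET ((xs @ [y]) ! i) ((xs @ [y]) ! Suc i)"
      proof (cases "Suc i < ?n")
        case False
        then have "i = ?n - 1" "Suc i = ?n" using i by auto
        then show ?thesis using that l by (simp add: nth_append)
      qed (auto simp: nth_append p)
    qed (use p y that inV in auto)
    then show False using longest by fastforce
  qed
  have n2: "?n \<ge> 2"
  proof (rule ccontr)
    assume "\<not> ?n \<ge> 2"
    then have xs1: "xs = [r]" using p by (cases xs; cases "tl xs") auto
    obtain y where y: "y \<in> VT" "y \<noteq> r" using ne r by blast
    have "(\<lambda>x y. x \<in> VT \<and> y \<in> VT \<and> ET x y)\<^sup>*\<^sup>* r y"
      using con r y unfolding connected_on_def by blast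
    then obtain z where "ET r z" using y(2) by (metis (no_types, lifting) converse_rtranclpE)
    then show False using on xs1 irr unfolding l_def by auto
  qed
  define m where "m = xs ! (?n - 2)"
  have Suc_n2: "Suc (?n - 2) = ?n - 1" using n2 by simp
  have lm: "ET l m"
    using p(5)[of "?n - 2"] n2 l sym Suc_n2 unfolding m_def by auto
  have uniq: "y = m" if ly: "ET l y" for y
  proof -
    obtain i where i: "i < ?n" "y = xs ! i" using on[OF ly] by (metis in_set_conv_nth)
    have "i \<noteq> ?n - 1" using ly irr l i by auto
    moreover have "\<not> i < ?n - 2"
    proof
      \<comment> \<open>A neighbour of \<open>l\<close> before the last but one position closes the
        tail \<open>drop i xs\<close> to a cycle.\<close>
      assume i2: "i < ?n - 2"
      have "cycle_in VT ET (drop i xs)"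
        unfolding cycle_in_def
        using i i2 p ly set_drop_subset[of i xs]
        by (auto simp: hd_drop_conv_nth l_def last_drop)
      then show False using acyc by blast
    qed
    ultimately have "i = ?n - 2" using i by simp
    then show ?thesis using i m_def by simp
  qed
  have "l \<noteq> r"
  proof
    assume "l = r"
    then have "xs ! (?n - 1) = xs ! 0" using p l by (simp add: hd_conv_nth)
    then show False using n2 p nth_eq_iff_index_eq[of xs "?n - 1" 0] by auto
  qed
  then show ?thesis using that[of l m] l lm uniq inV irr by blast
qed

lemma tree_remove_leaf:
  assumes tree: "is_tree VT ET" and l: "l \<in> VT" "m \<in> VT" "m \<noteq> l" "\<And>y. ET l y \<longleftrightarrow> y = m"
  shows "is_tree (VT - {l}) (\<lambda>x y. ET x y \<and> x \<noteq> l \<and> y \<noteq> l)" (is "is_tree ?V ?E")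
proof -
  have fin: "finite VT" and sim: "simple_graph VT ET" and con: "connected_on VT ET"
    and acyc: "\<And>xs. \<not> cycle_in VT ET xs"
    using tree unfolding is_tree_def fsc_graph_def by auto
  have sym: "ET x y \<Longrightarrow> ET y x" for x y
    using sim unfolding simple_graph_def by auto
  \<comment> \<open>Retracting \<open>l\<close> onto its only neighbour \<open>m\<close> turns a
    walk in the old tree into one avoiding \<open>l\<close>.\<close>
  define c where "c x = (if x = l then m else x)" for x
  have "connected_on ?V ?E"
    unfolding connected_on_def
  proof (intro ballI)
    fix u v assume uv: "u \<in> ?V" "v \<in> ?V"
    let ?R = "\<lambda>x y. x \<in> ?V \<and> y \<in> ?V \<and> ?E x y"
    have "(\<lambda>x y. x \<in> VT \<and> y \<in> VT \<and> ET x y)\<^sup>*\<^sup>* u v"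
      using con uv unfolding connected_on_def by blast
    then have "?R\<^sup>*\<^sup>* (c u) (c v)"
    proof induction
      case (step y z)
      have "c y = c z \<or> ?R (c y) (c z)"
      proof (cases "y = l \<or> z = l")
        case True
        then have "y = l \<and> z = m \<or> z = l \<and> y = m" using step.hyps l(4) sym by blast
        then show ?thesis unfolding c_def by auto
      next
        case False
        then show ?thesis using step.hyps unfolding c_def by auto
      qed
      then show ?case
      proof
        assume "c y = c z"
        then show ?thesis using step.IH by simp
      qed (rule rtranclp.rtrancl_into_rtrancl[OF step.IH])
    qed simp
    then show "?R\<^sup>*\<^sup>* u v" using uv unfolding c_def by simp
  qed
  moreover have "simple_graph ?V ?E" using sim unfolding simple_graph_def by auto
  moreover have "\<not> cycle_in ?V ?E xs" for xs
    using acyc[of xs] unfolding cycle_in_def by auto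
  ultimately show ?thesis using fin l unfolding is_tree_def fsc_graph_def by blast
qed

text \<open>By induction on the number of vertices: remove a leaf other than \<open>r\<close>, root
  the remaining tree, and hang the leaf back below its neighbour.\<close>

lemma rooted_tree_exists:
  assumes "is_tree VT ET" "r \<in> VT"
  shows "\<exists>p d. rooted_tree VT ET r p d"
  using assms
proof (induction "card VT" arbitrary: VT ET rule: less_induct)
  case less
  note tree = less.prems(1) and r = less.prems(2)
  have fin: "finite VT" and sim: "simple_graph VT ET"
    using tree unfolding is_tree_def fsc_graph_def by auto
  show ?case
  proof (cases "VT = {r}")
    case True
    then have "\<not> ET x y" for x y using sim unfolding simple_graph_def by (metis singletonD)
    then have "rooted_tree VT ET r id (\<lambda>_. 0)" using True by unfold_locales auto
    then show ?thesis by blast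
  next
    case False
    obtain l m where l: "l \<in> VT" "l \<noteq> r" "m \<in> VT" "m \<noteq> l" and nb: "\<And>y. ET l y \<longleftrightarrow> y = m"
      using tree_leaf[OF tree r False] by blast
    have sym: "ET x y \<longleftrightarrow> ET y x" for x y using sim unfolding simple_graph_def by auto
    have "card (VT - {l}) < card VT" using fin l by (intro psubset_card_mono) auto
    then obtain p d where
      rt: "rooted_tree (VT - {l}) (\<lambda>x y. ET x y \<and> x \<noteq> l \<and> y \<noteq> l) r p d"
      using less.hyps tree_remove_leaf[OF tree l(1,3,4) nb] r l(2) by blast
    interpret R: rooted_tree "VT - {l}" "\<lambda>x y. ET x y \<and> x \<noteq> l \<and> y \<noteq> l" r p d by (rule rt)
    have "rooted_tree VT ET r (p(l := m)) (d(l := Suc (d m)))"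
    proof
      show "ET x y \<longleftrightarrow> x \<in> VT \<and> y \<in> VT \<and>
        (x \<noteq> r \<and> y = (p(l := m)) x \<or> y \<noteq> r \<and> x = (p(l := m)) y)" for x y
      proof (cases "x = l \<or> y = l")
        case True
        then have "ET x y \<longleftrightarrow> x = l \<and> y = m \<or> y = l \<and> x = m" using nb sym by blast
        then show ?thesis using True R.parent_in[of x] R.parent_in[of y] l by auto
      next
        case False
        then show ?thesis using R.edge_iff[of x y] by auto
      qed
      show "(p(l := m)) x \<in> VT" "(d(l := Suc (d m))) ((p(l := m)) x) < (d(l := Suc (d m))) x"
        "(d(l := Suc (d m))) x = Suc ((d(l := Suc (d m))) ((p(l := m)) x))"
        if "x \<in> VT" "x \<noteq> r" for x
        using that l R.parent_in[of x] R.depth_parent[of x] by auto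
    qed (use fin r l R.depth_root in auto)
    then show ?thesis by blast
  qed
qed

section \<open>Path representations and the necessity of the chromatic bound\<close>

text \<open>The conditions of an \<open>(h,2,1)\<close>-representation without the bound on the host
  degree, which is kept apart because the host is modified later. The host type is
  arbitrary.\<close>

definition path_rep ::
  "'a set \<Rightarrow> ('a \<Rightarrow> 'a \<Rightarrow> bool) \<Rightarrow> 'b set \<Rightarrow> ('b \<Rightarrow> 'b \<Rightarrow> bool) \<Rightarrow> ('a \<Rightarrow> 'b set) \<Rightarrow> bool" where
  "path_rep V E VT ET Tv \<longleftrightarrow> is_tree VT ET \<and>
     (\<forall>v\<in>V. Tv v \<noteq> {} \<and> Tv v \<subseteq> VT \<and> connected_on (Tv v) ET \<and>
       (\<forall>x\<in>Tv v. deg_in (Tv v) ET x \<le> 2)) \<and>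
     (\<forall>v\<in>V. \<forall>w\<in>V. v \<noteq> w \<longrightarrow> (E v w \<longleftrightarrow> Tv v \<inter> Tv w \<noteq> {}))"

lemma hst_representation_iff:
  "hst_representation V E h 2 1 VT ET Tv \<longleftrightarrow> path_rep V E VT ET Tv \<and> max_deg_le VT ET h"
proof -
  have "Suc 0 \<le> card (Tv v \<inter> Tv w) \<longleftrightarrow> Tv v \<inter> Tv w \<noteq> {}"
    if "is_tree VT ET" "Tv v \<subseteq> VT" for v w
    using that card_gt_0_iff[of "Tv v \<inter> Tv w"] finite_subset[of "Tv v \<inter> Tv w" VT]
    unfolding is_tree_def fsc_graph_def by auto
  then show ?thesis
    unfolding hst_representation_def path_rep_def is_subtree_def max_deg_le_def numeral_eq_enat
    by (auto simp: Ball_def)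
qed

lemma in_class_iff:
  "in_class V E h 2 1 \<longleftrightarrow> (\<exists>(VT :: nat set) ET Tv. path_rep V E VT ET Tv \<and> max_deg_le VT ET h)"
  unfolding in_class_def hst_representation_iff ..

locale rooted_rep = rooted_tree VT ET r p d
  for VT :: "'b set" and ET r p d +
  fixes V :: "'a set" and E :: "'a \<Rightarrow> 'a \<Rightarrow> bool" and Tv :: "'a \<Rightarrow> 'b set" and t :: "'a \<Rightarrow> 'b"
  assumes finite_V: "finite V"
    and simple: "simple_graph V E"
    and top: "v \<in> V \<Longrightarrow> topped (Tv v) (t v)"
    and deg2: "v \<in> V \<Longrightarrow> x \<in> Tv v \<Longrightarrow> deg_in (Tv v) ET x \<le> 2"
    and adj: "v \<in> V \<Longrightarrow> w \<in> V \<Longrightarrow> v \<noteq> w \<Longrightarrow> E v w \<longleftrightarrow> Tv v \<inter> Tv w \<noteq> {}"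

text \<open>Any host vertex may serve as the root, so each local argument can be carried out at the
  root and then transferred by rerooting.\<close>

lemma rooted_rep_exists:
  assumes fin: "finite V" and sim: "simple_graph V E"
    and rep: "path_rep V E VT ET Tv" and r: "r \<in> VT"
  obtains p d t where "rooted_rep VT ET r p d V E Tv t"
proof -
  obtain p d where rt: "rooted_tree VT ET r p d"
    using rooted_tree_exists[of VT ET r] rep r by (auto simp: path_rep_def)
  interpret rooted_tree VT ET r p d by (rule rt)
  have "\<exists>t. topped (Tv v) t" if "v \<in> V" for v
  proof -
    have "Tv v \<noteq> {}" "Tv v \<subseteq> VT" "connected_on (Tv v) ET"
      using that rep by (auto simp: path_rep_def)
    then show ?thesis using connected_topped by blast
  qed
  then obtain t where "\<And>v. v \<in> V \<Longrightarrow> topped (Tv v) (t v)" by metis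
  then have "rooted_rep VT ET r p d V E Tv t"
    using fin sim rep unfolding path_rep_def by unfold_locales auto
  then show ?thesis by (rule that)
qed

section \<open>Ancestors, and paths through the root\<close>

context rooted_tree
begin

lemma up_up:
  assumes "m \<le> n" "n \<le> d x" "x \<in> VT"
  shows "up (up x n) m = up x m"
proof -
  have "d (up x n) = n" using up_in[OF assms(3)] assms(2) by auto
  then have "up (up x n) m = (p ^^ (n - m)) ((p ^^ (d x - n)) x)" unfolding up_def by simp
  also have "\<dots> = (p ^^ (n - m + (d x - n))) x" by (simp add: funpow_add)
  also have "n - m + (d x - n) = d x - m" using assms by simp
  finally show ?thesis unfolding up_def .
qed

lemma up_0: "x \<in> VT \<Longrightarrow> up x 0 = r"
  using up_in[of x 0] depth_0 by auto

lemma edge_root_iff: "ET r y \<longleftrightarrow> y \<in> VT \<and> y \<noteq> r \<and> p y = r"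
  unfolding edge_iff using root_in by auto

lemma up_1_edge:
  assumes "x \<in> VT" "x \<noteq> r"
  shows "ET r (up x 1)"
proof -
  have dx: "0 < d x" using depth_parent[OF assms] by simp
  then have "d (up x 1) = 1" "up x 1 \<in> VT" using up_in[OF assms(1), of 1] by auto
  moreover have "p (up x 1) = r" using up_Suc[OF assms(1) dx] up_0[OF assms(1)] by simp
  ultimately show ?thesis unfolding edge_root_iff using depth_root by auto
qed

lemma depth_root_edge: "ET r y \<Longrightarrow> d y = 1"
  unfolding edge_root_iff using depth_parent[of y] depth_root by auto

end

context rooted_rep
begin

lemma Tv_sub: "v \<in> V \<Longrightarrow> Tv v \<subseteq> VT"
  using top unfolding topped_def by blast

lemma top_in: "v \<in> V \<Longrightarrow> t v \<in> Tv v"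
  using top unfolding topped_def by blast

lemma finite_Tv: "v \<in> V \<Longrightarrow> finite (Tv v)"
  using Tv_sub finite_VT finite_subset by blast

lemma root_closed:
  assumes "c \<in> V" "r \<in> Tv c" "x \<in> Tv c" "x \<noteq> r"
  shows "p x \<in> Tv c"
  using top[OF assms(1)] topped_root[OF top[OF assms(1)] assms(2)] assms(3,4)
  unfolding topped_def by auto

lemma root_up:
  assumes "c \<in> V" "r \<in> Tv c" "x \<in> Tv c"
  shows "up x n \<in> Tv c"
  using topped_up[OF top[OF assms(1)] assms(3)] topped_root[OF top[OF assms(1)] assms(2)] depth_root
  by auto

text \<open>A path through the root contains all ancestors of its vertices, and \<open>t v\<close>
  is an ancestor of every vertex of \<open>Tv v\<close>; so any meeting of the two paths forces
  \<open>t v\<close> into \<open>Tv c\<close>.\<close>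

lemma root_adj:
  assumes "c \<in> V" "r \<in> Tv c" "v \<in> V" "c \<noteq> v"
  shows "E c v \<longleftrightarrow> t v \<in> Tv c"
proof
  assume "E c v"
  then obtain x where x: "x \<in> Tv c" "x \<in> Tv v" using adj assms by blast
  have "up x (d (t v)) = t v" using topped_up[OF top[OF assms(3)] x(2)] by blast
  then show "t v \<in> Tv c" using root_up[OF assms(1,2) x(1)] by metis
next
  assume "t v \<in> Tv c"
  then show "E c v" using adj assms top[OF assms(3)] unfolding topped_def by blast
qed

text \<open>Two children together with the parent of \<open>p a\<close> would give
  \<open>p a\<close> degree 3 on the path. The root is excluded because it has no parent: there a
  path may continue into two branches.\<close>

lemma one_child:
  assumes c: "c \<in> V" "r \<in> Tv c" and a: "a \<in> Tv c" "a \<noteq> r" and b: "b \<in> Tv c" "b \<noteq> r"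
    and par: "p a = p b" "p a \<noteq> r"
  shows "a = b"
proof (rule ccontr)
  assume ab: "a \<noteq> b"
  let ?x = "p a"
  have V: "a \<in> VT" "b \<in> VT" using a b Tv_sub c by auto
  have x: "?x \<in> Tv c" "p ?x \<in> Tv c" using root_closed[OF c] a par by metis+
  have xV: "?x \<in> VT" "p ?x \<in> VT" using x Tv_sub c by auto
  have "d (p ?x) < d ?x" "d ?x < d a" "d ?x < d b"
    using rank_parent[OF V(1) a(2)] rank_parent[OF V(2) b(2)] rank_parent[OF xV(1) par(2)] par by auto
  then have "p ?x \<noteq> a" "p ?x \<noteq> b" by auto
  then have "card {p ?x, a, b} = 3" using ab by simp
  moreover have "{p ?x, a, b} \<subseteq> {y \<in> Tv c. ET ?x y}"
    using x xV V a b par unfolding edge_iff by auto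
  ultimately have "3 \<le> deg_in (Tv c) ET ?x"
    unfolding deg_in_def using card_mono[of "{y \<in> Tv c. ET ?x y}" "{p ?x, a, b}"] finite_Tv[OF c(1)]
    by simp
  then show False using deg2[OF c(1) x(1)] by simp
qed

text \<open>Within one branch at the root a path through the root is a chain: passing to parents
  keeps depths and branch equal until depth 1, and \<open>one_child\<close> allows no divergence on
  the way down.\<close>

lemma level_unique:
  assumes c: "c \<in> V" "r \<in> Tv c" and ab: "a \<in> Tv c" "b \<in> Tv c" "d a = d b" "up a 1 = up b 1"
  shows "a = b"
  using ab
proof (induction "d a" arbitrary: a b)
  case 0
  then show ?case using depth_0 Tv_sub c by (metis subsetD)
next
  case (Suc n)
  have V: "a \<in> VT" "b \<in> VT" "a \<noteq> r" "b \<noteq> r"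
    using Suc Tv_sub c depth_root by auto
  show ?case
  proof (cases "n = 0")
    case True
    then show ?thesis using Suc up_self[of a 1] up_self[of b 1] by simp
  next
    case False
    have da: "d (p a) = n" "d (p b) = n" using depth_parent V Suc by auto
    have "up (p a) 1 = up (p b) 1"
      using up_parent[of a 1] up_parent[of b 1] V False Suc by auto
    then have "p a = p b" using Suc(1)[of "p a" "p b"] da root_closed c Suc V by auto
    moreover have "p a \<noteq> r" using da False depth_root by auto
    ultimately show ?thesis using one_child c Suc V by blast
  qed
qed

lemma branch_comparable:
  assumes c: "c \<in> V" "r \<in> Tv c" and ab: "a \<in> Tv c" "b \<in> Tv c" "1 \<le> d a" "d a \<le> d b"
    and br: "up a 1 = up b 1"
  shows "up b (d a) = a"
proof -
  have b: "b \<in> VT" using Tv_sub c ab by auto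
  have "up b (d a) \<in> Tv c" using root_up c ab by blast
  moreover have "d (up b (d a)) = d a" using up_in[OF b] ab by auto
  moreover have "up (up b (d a)) 1 = up a 1" using up_up[OF ab(3,4) b] br by simp
  ultimately show ?thesis using level_unique[OF c] ab by blast
qed

lemma branch_colouring:
  assumes C: "C = {v \<in> V. r \<in> Tv v}" and deg: "card {y. ET r y} \<le> h"
  shows "\<exists>f. proper_colouring (branch_vertices V E C) (branch_edge V E C) f h"
proof -
  have "finite {y. ET r y}"
    using finite_subset[OF _ finite_VT, of "{y. ET r y}"] unfolding edge_iff by auto
  then obtain g where "bij_betw g {y. ET r y} {0..<card {y. ET r y}}"
    using ex_bij_betw_finite_nat by blast
  then have g: "inj_on g {y. ET r y}" "g ` {y. ET r y} = {0..<card {y. ET r y}}"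
    unfolding bij_betw_def by auto
  have tV: "t v \<in> VT" "t v \<noteq> r" if "v \<in> branch_vertices V E C" for v
    using that top_in[of v] Tv_sub[of v] unfolding branch_vertices_def C by auto
  \<comment> \<open>The path of the common neighbour \<open>c\<close> contains both tops, so
    \<open>t v\<close> is an ancestor of \<open>t w\<close>. Hence the path of \<open>w'\<close>,
    which contains \<open>t w\<close>, also contains \<open>t v\<close>, against condition (3) of
    the branch graph.\<close>
  have nested: False
    if e: "branch_edge V E C v w" and same: "up (t v) 1 = up (t w) 1" and le: "d (t v) \<le> d (t w)" for v w
  proof -
    have bv: "v \<in> branch_vertices V E C" "w \<in> branch_vertices V E C"
      using e unfolding branch_edge_def by auto
    then have vw: "v \<in> V" "v \<notin> C" "w \<in> V" "w \<notin> C" unfolding branch_vertices_def by auto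
    have ad: "E c x \<longleftrightarrow> t x \<in> Tv c" if "c \<in> C" "x = v \<or> x = w" for c x
      using root_adj[of c x] that vw unfolding C by auto
    obtain c w' where c: "c \<in> C" "E c v" "E c w" "w' \<in> C" "E w' w" "\<not> E w' v"
      using e unfolding branch_edge_def by auto
    have "1 \<le> d (t v)" using tV[OF bv(1)] depth_parent[of "t v"] by auto
    then have "up (t w) (d (t v)) = t v"
      using branch_comparable[of c "t v" "t w"] c ad same le unfolding C by auto
    then have "t v \<in> Tv w'"
      using root_up[of w' "t w" "d (t v)"] c ad unfolding C by auto
    then show False using c ad by auto
  qed
  have "proper_colouring (branch_vertices V E C) (branch_edge V E C) (\<lambda>v. g (up (t v) 1)) h"
    unfolding proper_colouring_def
  proof (intro conjI ballI impI)
    fix v assume v: "v \<in> branch_vertices V E C"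
    then have "g (up (t v) 1) \<in> g ` {y. ET r y}" using up_1_edge tV by auto
    then show "g (up (t v) 1) < h" using g(2) deg by auto
  next
    fix v w assume vw: "v \<in> branch_vertices V E C" "w \<in> branch_vertices V E C"
      and e: "branch_edge V E C v w"
    \<comment> \<open>Symmetry allows either of the two tops to be the shallower one in
      \<open>nested\<close>.\<close>
    have e': "branch_edge V E C w v"
      using e simple unfolding branch_edge_def simple_graph_def by blast
    show "g (up (t v) 1) \<noteq> g (up (t w) 1)"
    proof
      assume "g (up (t v) 1) = g (up (t w) 1)"
      then have "up (t v) 1 = up (t w) 1"
        using g(1) up_1_edge tV vw by (auto simp: inj_on_def)
      then show False using nested[of v w] nested[of w v] e e' by (metis nle_le)
    qed
  qed
  then show ?thesis by blast
qed

lemma complete_helly: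
  assumes "complete_set V E K" "K \<noteq> {}"
  obtains q where "q \<in> VT" "\<And>v. v \<in> K \<Longrightarrow> q \<in> Tv v"
proof -
  have K: "K \<subseteq> V" "\<And>v w. v \<in> K \<Longrightarrow> w \<in> K \<Longrightarrow> v \<noteq> w \<Longrightarrow> E v w"
    using assms unfolding complete_set_def by auto
  have "Tv v \<inter> Tv w \<noteq> {}" if "v \<in> K" "w \<in> K" for v w
  proof (cases "v = w")
    case True
    then show ?thesis using top[of v] that K(1) unfolding topped_def by auto
  next
    case False
    then show ?thesis using adj that K by blast
  qed
  then show ?thesis
    using helly[of K Tv t] top K(1) finite_subset[OF K(1) finite_V] assms(2) that by blast
qed

end

section \<open>Chromatic numbers and cliques\<close>

lemma chromatic_number_le_iff:
  assumes fin: "finite W" and irr: "\<And>x. \<not> F x x"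
  shows "chromatic_number W F \<le> h \<longleftrightarrow> (\<exists>f. proper_colouring W F f h)"
    (is "?l \<longleftrightarrow> ?r")
proof
  assume ?r
  then show ?l unfolding chromatic_number_def by (rule Least_le)
next
  assume le: ?l
  \<comment> \<open>An injective colouring shows that some number of colours works, so the
    \<open>LEAST\<close> in the definition is attained; extra colours then do no harm.\<close>
  obtain g where "bij_betw g W {0..<card W}" using ex_bij_betw_finite_nat[OF fin] by blast
  then have g: "inj_on g W" "g ` W = {0..<card W}" unfolding bij_betw_def by auto
  have "\<forall>x\<in>W. g x < card W" using g(2) by auto
  then have "proper_colouring W F g (card W)"
    using irr g(1) by (auto simp: proper_colouring_def dest: inj_onD)
  then have "\<exists>f. proper_colouring W F f (chromatic_number W F)"
    unfolding chromatic_number_def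
    using LeastI[of "\<lambda>k. \<exists>f. proper_colouring W F f k" "card W"] by blast
  then show ?r using le unfolding proper_colouring_def by (meson order_less_le_trans)
qed

lemma chromatic_branch_le_iff:
  assumes "finite V"
  shows "chromatic_number (branch_vertices V E C) (branch_edge V E C) \<le> h \<longleftrightarrow>
    (\<exists>f. proper_colouring (branch_vertices V E C) (branch_edge V E C) f h)"
  using assms by (intro chromatic_number_le_iff) (auto simp: branch_vertices_def branch_edge_def)

lemma cliques_finite_nonempty:
  assumes "fsc_graph V E"
  shows "cliques V E \<noteq> {}" "finite (cliques V E)" "{} \<notin> cliques V E"
proof -
  have fin: "finite V" and "V \<noteq> {}" using assms unfolding fsc_graph_def by auto
  then obtain v where v: "v \<in> V" by blast
  let ?A = "{K. complete_set V E K}"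
  have sub: "?A \<subseteq> Pow V" unfolding complete_set_def by auto
  then have finA: "finite ?A" using fin finite_subset by blast
  have vA: "{v} \<in> ?A" using v unfolding complete_set_def by auto
  obtain C where "C \<in> ?A" "\<And>K. K \<in> ?A \<Longrightarrow> C \<le> K \<Longrightarrow> C = K"
    using finite_has_maximal[OF finA] vA by auto
  then have "C \<in> cliques V E" unfolding cliques_def is_clique_def by auto
  then show "cliques V E \<noteq> {}" by blast
  show "finite (cliques V E)"
    by (rule finite_subset[OF _ finA]) (auto simp: cliques_def is_clique_def)
  show "{} \<notin> cliques V E"
    using vA unfolding cliques_def is_clique_def by auto
qed

lemma in_class_chromatic_le:
  assumes G: "fsc_graph V E" and cls: "in_class V E (enat h) 2 1" and C: "C \<in> cliques V E"
  shows "chromatic_number (branch_vertices V E C) (branch_edge V E C) \<le> h"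
proof -
  obtain VT :: "nat set" and ET Tv where rep: "path_rep V E VT ET Tv" and deg: "max_deg_le VT ET (enat h)"
    using cls unfolding in_class_iff by blast
  have fin: "finite V" and sim: "simple_graph V E" using G unfolding fsc_graph_def by auto
  obtain r where r: "r \<in> VT" using rep unfolding path_rep_def is_tree_def fsc_graph_def by auto
  obtain p d t where "rooted_rep VT ET r p d V E Tv t"
    using rooted_rep_exists[OF fin sim rep r] .
  then interpret R: rooted_rep VT ET r p d V E Tv t .
  have cl: "complete_set V E C" "\<And>K. complete_set V E K \<Longrightarrow> C \<subseteq> K \<Longrightarrow> K = C"
    using C unfolding cliques_def is_clique_def by auto
  have "C \<noteq> {}" using cliques_finite_nonempty(3)[OF G] C by auto
  then obtain q where q: "q \<in> VT" "\<And>v. v \<in> C \<Longrightarrow> q \<in> Tv v"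
    using R.complete_helly[OF cl(1)] by blast
  have CV: "C \<subseteq> V" using cl(1) unfolding complete_set_def by auto
  have "complete_set V E {v \<in> V. q \<in> Tv v}"
    using R.adj unfolding complete_set_def by auto
  \<comment> \<open>All paths through \<open>q\<close> form a complete set containing
    \<open>C\<close>, so maximality gives equality. The first root served only to find
    \<open>q\<close>; the colouring needs \<open>q\<close> itself as the root.\<close>
  then have Ceq: "C = {v \<in> V. q \<in> Tv v}" using cl(2) q CV by blast
  obtain p' d' t' where "rooted_rep VT ET q p' d' V E Tv t'"
    using rooted_rep_exists[OF fin sim rep q(1)] .
  then interpret Q: rooted_rep VT ET q p' d' V E Tv t' .
  have "{y. ET q y} = {y \<in> VT. ET q y}" unfolding Q.edge_iff by auto
  then have "card {y. ET q y} \<le> h"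
    using deg q(1) unfolding max_deg_le_def deg_in_def by auto
  then show ?thesis using Q.branch_colouring[OF Ceq] chromatic_branch_le_iff[OF fin] by blast
qed

section \<open>Minimal representations\<close>

lemma (in ranked_tree) path_repI:
  assumes "\<And>v. v \<in> V \<Longrightarrow> topped (S v) (t v)"
    and "\<And>v x. v \<in> V \<Longrightarrow> x \<in> S v \<Longrightarrow> deg_in (S v) ET x \<le> 2"
    and "\<And>v w. v \<in> V \<Longrightarrow> w \<in> V \<Longrightarrow> v \<noteq> w \<Longrightarrow> E v w \<longleftrightarrow> S v \<inter> S w \<noteq> {}"
  shows "path_rep V E VT ET S"
proof -
  have "S v \<noteq> {} \<and> S v \<subseteq> VT \<and> connected_on (S v) ET" if "v \<in> V" for v
    using topped_connected[OF assms(1)[OF that]] assms(1)[OF that] unfolding topped_def by blast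
  then show ?thesis using is_tree assms(2,3) by (simp add: path_rep_def)
qed

context rooted_rep
begin

text \<open>Contracting \<open>y\<close> into \<open>r\<close> loses no adjacency, because paths
  meeting at \<open>y\<close> also meet at \<open>r\<close>. It creates none either, because the new
  paths are subsets of the old ones.\<close>

lemma contract_root_edge:
  assumes y: "ET r y" and sub: "\<And>v. v \<in> V \<Longrightarrow> y \<in> Tv v \<Longrightarrow> r \<in> Tv v"
  shows "\<exists>ET' Tv'. path_rep V E (VT - {y}) ET' Tv'"
proof -
  have yV: "y \<in> VT" "y \<noteq> r" "p y = r" using y unfolding edge_root_iff by auto
  \<comment> \<open>The children of \<open>y\<close> become children of \<open>r\<close>. The old
    \<open>d\<close> still decreases along \<open>p'\<close> but is no longer the depth.\<close>
  define p' where "p' x = (if p x = y then r else p x)" for x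
  define ET' where "ET' a b \<longleftrightarrow> a \<in> VT - {y} \<and> b \<in> VT - {y} \<and>
    (a \<noteq> r \<and> b = p' a \<or> b \<noteq> r \<and> a = p' b)" for a b
  interpret N: ranked_tree "VT - {y}" ET' r p' d
  proof
    show "p' x \<in> VT - {y}" "d (p' x) < d x" if "x \<in> VT - {y}" "x \<noteq> r" for x
      using that parent_in[of x] rank_parent[of x] depth_root root_in yV unfolding p'_def by auto
  qed (use finite_VT root_in yV ET'_def in auto)
  have topped': "N.topped (Tv v - {y}) (t v)" if v: "v \<in> V" for v
  proof -
    have "t v \<noteq> y"
    proof
      assume "t v = y"
      then have "r \<in> Tv v" using sub[OF v] top_in[OF v] by auto
      then show False using topped_root[OF top[OF v]] \<open>t v = y\<close> yV by auto
    qed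
    moreover have "x \<noteq> r \<and> p' x \<in> Tv v - {y}" if x: "x \<in> Tv v" "x \<noteq> t v" for x
    proof -
      have "x \<noteq> r" "p x \<in> Tv v" using x top[OF v] unfolding topped_def by auto
      then show ?thesis using sub[OF v] yV unfolding p'_def by auto
    qed
    ultimately show ?thesis
      unfolding N.topped_def using Tv_sub[OF v] top_in[OF v] by auto
  qed
  have deg': "deg_in (Tv v - {y}) ET' x \<le> 2" if v: "v \<in> V" and x: "x \<in> Tv v - {y}" for v x
  proof -
    let ?B' = "{b \<in> Tv v - {y}. ET' x b}" and ?B = "\<lambda>x. {b \<in> Tv v. ET x b}"
    have fin: "finite (?B z)" for z using finite_Tv[OF v] by simp
    have card2: "card (?B z) \<le> 2" if "z \<in> Tv v" for z using deg2[OF v that] unfolding deg_in_def .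
    have inVT: "z \<in> VT" if "z \<in> Tv v" for z using that Tv_sub[OF v] by auto
    have closed: "p z \<in> Tv v" if "r \<in> Tv v" "z \<in> Tv v" "z \<noteq> r" for z
      using root_closed[OF v] that .
    show ?thesis
    proof (cases "x = r")
      case False
      \<comment> \<open>Away from \<open>r\<close> the new neighbours on the path are the old ones
        with \<open>y\<close> renamed to \<open>r\<close>, so the degree cannot grow.\<close>
      have "?B' \<subseteq> (\<lambda>b. if b = y then r else b) ` ?B x"
      proof
        fix b assume b: "b \<in> ?B'"
        show "b \<in> (\<lambda>b. if b = y then r else b) ` ?B x"
        proof (cases "p x = y \<and> b = r")
          case True
          then have "y \<in> Tv v" using closed[of x] b x False by auto
          then have "y \<in> ?B x" using True x inVT False unfolding edge_iff by auto
          then show ?thesis using True by force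
        next
          case ne: False
          then have "ET x b" using b False x inVT yV unfolding ET'_def edge_iff p'_def
            by (auto split: if_splits)
          then show ?thesis using b by force
        qed
      qed
      then have "card ?B' \<le> card (?B x)" using fin by (meson surj_card_le)
      then show ?thesis using card2[of x] x unfolding deg_in_def by auto
    next
      case True
      then have r: "r \<in> Tv v" using x by auto
      have B': "?B' \<subseteq> (?B r - {y}) \<union> {b \<in> Tv v. b \<noteq> r \<and> p b = y}"
        using True r inVT unfolding ET'_def edge_iff p'_def by (auto split: if_splits)
      show ?thesis
      proof (cases "y \<in> Tv v")
        case False
        then have "{b \<in> Tv v. b \<noteq> r \<and> p b = y} = {}" using closed[OF r] by auto
        then have "card ?B' \<le> card (?B r)" using B' fin by (intro card_mono) auto
        then show ?thesis using card2[OF r] unfolding deg_in_def by simp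
      next
        case yT: True
        \<comment> \<open>The edge between \<open>r\<close> and \<open>y\<close> uses up one of the
          two path neighbours of each. At most one other neighbour remains on either side, and these
          are the new neighbours of \<open>r\<close>.\<close>
        have "card (?B r - {y}) \<le> 1" using card2[OF r] yT y fin by (simp add: card_Diff_singleton)
        moreover have "r \<in> ?B y" using r y edge_sym by auto
        then have "card (?B y - {r}) \<le> 1" using card2[OF yT] fin by (simp add: card_Diff_singleton)
        moreover have "?B' \<subseteq> (?B r - {y}) \<union> (?B y - {r})"
          using B' inVT yV unfolding edge_iff by auto
        then have "card ?B' \<le> card ((?B r - {y}) \<union> (?B y - {r}))"
          using fin by (intro card_mono) auto
        moreover have "\<dots> \<le> card (?B r - {y}) + card (?B y - {r})" by (rule card_Un_le)
        ultimately show ?thesis unfolding deg_in_def by linarith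
      qed
    qed
  qed
  have "E v w \<longleftrightarrow> (Tv v - {y}) \<inter> (Tv w - {y}) \<noteq> {}" if vw: "v \<in> V" "w \<in> V" "v \<noteq> w" for v w
  proof -
    have "r \<in> (Tv v - {y}) \<inter> (Tv w - {y})" if "y \<in> Tv v" "y \<in> Tv w"
      using sub vw that yV by auto
    then have "Tv v \<inter> Tv w \<noteq> {} \<longleftrightarrow> (Tv v - {y}) \<inter> (Tv w - {y}) \<noteq> {}" by blast
    then show ?thesis using adj[OF vw] by simp
  qed
  then have "path_rep V E (VT - {y}) ET' (\<lambda>v. Tv v - {y})"
    by (intro N.path_repI[where t = t] topped' deg')
  then show ?thesis by blast
qed

lemma root_clique:
  assumes priv: "\<And>y. ET r y \<Longrightarrow> \<exists>v\<in>V. r \<in> Tv v \<and> y \<notin> Tv v"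
  shows "{v \<in> V. r \<in> Tv v} \<in> cliques V E" (is "?C \<in> _")
proof -
  have "K = ?C" if K: "complete_set V E K" "?C \<subseteq> K" for K
  proof (cases "K = {}")
    case False
    then obtain q where q: "q \<in> VT" "\<And>v. v \<in> K \<Longrightarrow> q \<in> Tv v"
      using complete_helly[OF K(1)] by blast
    \<comment> \<open>Otherwise every path through \<open>r\<close> also contains \<open>q\<close>,
      hence the neighbour of \<open>r\<close> towards \<open>q\<close>, contrary to
      \<open>priv\<close>.\<close>
    have "q = r"
    proof (rule ccontr)
      assume "q \<noteq> r"
      then have "ET r (up q 1)" using up_1_edge q by blast
      then obtain v where "v \<in> V" "r \<in> Tv v" "up q 1 \<notin> Tv v" using priv by blast
      then show False using root_up[of v q 1] q K(2) by auto
    qed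
    then show ?thesis using q K unfolding complete_set_def by auto
  qed (use K in auto)
  moreover have "complete_set V E ?C" using adj unfolding complete_set_def by auto
  ultimately show ?thesis unfolding cliques_def is_clique_def by blast
qed

end

text \<open>If \<open>N a \<subseteq> N b\<close> then \<open>b\<close> is the only index whose set meets \<open>N a\<close>, so \<open>a\<close> can be recoloured
  at will, avoiding one colour only.\<close>
lemma recolour_comparable:
  fixes N :: "'b \<Rightarrow> 'a set" and g :: "'b \<Rightarrow> nat"
  assumes fin: "finite Y" and h: "h \<ge> 2" and g: "\<And>y. y \<in> Y \<Longrightarrow> g y < h"
    and two: "\<And>v a b c. \<lbrakk>a \<in> Y; b \<in> Y; c \<in> Y; v \<in> N a; v \<in> N b; v \<in> N c\<rbrakk> \<Longrightarrow> a = b \<or> a = c \<or> b = c"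
    and inc: "\<And>a b. \<lbrakk>a \<in> Y; b \<in> Y; N a \<inter> N b \<noteq> {}; \<not> N a \<subseteq> N b; \<not> N b \<subseteq> N a\<rbrakk> \<Longrightarrow> g a \<noteq> g b"
  shows "\<exists>g'. (\<forall>y\<in>Y. g' y < h) \<and> (\<forall>a\<in>Y. \<forall>b\<in>Y. a \<noteq> b \<longrightarrow> N a \<inter> N b \<noteq> {} \<longrightarrow> g' a \<noteq> g' b)"
proof -
  obtain k :: "'b \<Rightarrow> nat" where k: "inj_on k Y"
    using finite_imp_inj_to_nat_seg[OF fin] by blast
  \<comment> \<open>\<open>L a\<close> marks the indices to be recoloured, and \<open>m a\<close> is
    then the only other index whose set meets \<open>N a\<close>.\<close>
  define P where "P a b \<longleftrightarrow> b \<in> Y \<and> b \<noteq> a \<and> N a \<noteq> {} \<and> N a \<subseteq> N b" for a b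
  define L where "L a \<longleftrightarrow> (\<exists>b. P a b)" for a
  define m where "m a = (SOME b. P a b)" for a
  have m: "P a (m a)" if "L a" for a using that someI_ex[of "P a"] unfolding L_def m_def by blast
  have uniq: "m a = c" if "L a" "a \<in> Y" "c \<in> Y" "a \<noteq> c" "N a \<inter> N c \<noteq> {}" for a c
  proof -
    obtain v where v: "v \<in> N a" "v \<in> N c" using \<open>N a \<inter> N c \<noteq> {}\<close> by blast
    have ma: "m a \<in> Y" "m a \<noteq> a" "v \<in> N (m a)" using m[OF \<open>L a\<close>] v unfolding P_def by auto
    show ?thesis using two[OF \<open>a \<in> Y\<close> \<open>c \<in> Y\<close> ma(1) v ma(3)] ma(2) \<open>a \<noteq> c\<close> by auto
  qed
  \<comment> \<open>If \<open>m a\<close> is marked too, the two indices only conflict with each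
    other, and the injection \<open>k\<close> decides which gets 0 and which gets 1. Otherwise
    \<open>m a\<close> keeps its colour and \<open>a\<close> takes one of 0, 1 that differs from
    it.\<close>
  define g' where "g' a = (if \<not> L a then g a
      else if L (m a) then (if k a < k (m a) then 0 else 1)
      else if g (m a) = 0 then 1 else 0)" for a
  have "g' a \<noteq> g' b" if ab: "a \<in> Y" "b \<in> Y" "a \<noteq> b" "N a \<inter> N b \<noteq> {}" for a b
  proof -
    have ma: "L a \<Longrightarrow> m a = b" and mb: "L b \<Longrightarrow> m b = a"
      using uniq[of a b] uniq[of b a] ab by auto
    show ?thesis
    proof (cases "L a \<or> L b")
      case False
      then have "\<not> N a \<subseteq> N b" "\<not> N b \<subseteq> N a" using ab unfolding L_def P_def by auto
      then show ?thesis using inc ab False unfolding g'_def by simp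
    next
      case True
      moreover have "k a \<noteq> k b" using k ab by (meson inj_onD)
      ultimately show ?thesis using ma mb unfolding g'_def by auto
    qed
  qed
  moreover have "g' y < h" if "y \<in> Y" for y using that g h unfolding g'_def by auto
  ultimately show ?thesis by blast
qed

section \<open>Local colourings at host vertices\<close>

text \<open>This is \<open>h\<close>-colourability of the graph on the neighbours of
  \<open>x\<close> in which two are joined when some path passes through both and \<open>x\<close>.
  It is the invariant preserved by splitting.\<close>

definition colourable_at ::
  "'a set \<Rightarrow> ('b \<Rightarrow> 'b \<Rightarrow> bool) \<Rightarrow> ('a \<Rightarrow> 'b set) \<Rightarrow> nat \<Rightarrow> 'b \<Rightarrow> bool" where
  "colourable_at V ET Tv h x \<longleftrightarrow> (\<exists>g. (\<forall>y. ET x y \<longrightarrow> g y < h) \<and>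
     (\<forall>y y'. ET x y \<longrightarrow> ET x y' \<longrightarrow> y \<noteq> y' \<longrightarrow>
       (\<exists>v\<in>V. {x, y, y'} \<subseteq> Tv v) \<longrightarrow> g y \<noteq> g y'))"

lemma colourable_atI:
  assumes "\<And>y. ET x y \<Longrightarrow> g y < h"
    and "\<And>y y' v. \<lbrakk>ET x y; ET x y'; y \<noteq> y'; v \<in> V; {x, y, y'} \<subseteq> Tv v\<rbrakk> \<Longrightarrow> g y \<noteq> g y'"
  shows "colourable_at V ET Tv h x"
  unfolding colourable_at_def using assms by (intro exI[of _ g]) auto

lemma colourable_atE:
  assumes "colourable_at V ET Tv h x"
  obtains g where "\<And>y. ET x y \<Longrightarrow> g y < h"
    "\<And>y y' v. \<lbrakk>ET x y; ET x y'; y \<noteq> y'; v \<in> V; {x, y, y'} \<subseteq> Tv v\<rbrakk> \<Longrightarrow> g y \<noteq> g y'"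
  using assms unfolding colourable_at_def by blast

lemma (in rooted_rep) root_colourable:
  assumes out: "\<And>y. ET r y \<Longrightarrow> \<exists>v\<in>V. y \<in> Tv v \<and> r \<notin> Tv v"
    and C: "C = {v \<in> V. r \<in> Tv v}" and h: "h \<ge> 2"
    and col: "proper_colouring (branch_vertices V E C) (branch_edge V E C) f h"
  shows "colourable_at V ET Tv h r"
proof -
  let ?Y = "{y. ET r y}"
  define N where "N y = {v \<in> V. r \<in> Tv v \<and> y \<in> Tv v}" for y
  \<comment> \<open>\<open>w y\<close> is a graph vertex standing for the host neighbour
    \<open>y\<close>: its path avoids \<open>r\<close> and contains \<open>y\<close>, so its top is
    \<open>y\<close>, and its neighbours in \<open>C\<close> are exactly \<open>N y\<close>.\<close>
  obtain w where w: "\<And>y. ET r y \<Longrightarrow> w y \<in> V \<and> y \<in> Tv (w y) \<and> r \<notin> Tv (w y)"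
    using out by metis
  have tw: "t (w y) = y" if "ET r y" for y
    using w[OF that] top[of "w y"] that unfolding topped_def edge_root_iff by metis
  have adjw: "E c (w y) \<longleftrightarrow> c \<in> N y" if "c \<in> C" "ET r y" for c y
  proof -
    have "c \<noteq> w y" using that w unfolding C by auto
    then show ?thesis using root_adj[of c "w y"] that w tw unfolding C N_def by auto
  qed
  have NC: "N y \<subseteq> C" for y unfolding N_def C by auto
  have sym: "E a b \<Longrightarrow> E b a" for a b using simple unfolding simple_graph_def by blast
  have bv: "w y \<in> branch_vertices V E C" if "ET r y" "N y \<noteq> {}" for y
    using that w adjw NC sym unfolding branch_vertices_def C by blast
  have fin: "finite ?Y"
    using finite_subset[OF _ finite_VT, of ?Y] unfolding edge_iff by auto
  \<comment> \<open>If \<open>N y\<close> is empty, \<open>w y\<close> has no neighbour in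
    \<open>C\<close> and is not a branch vertex, so \<open>f\<close> gives no bound there; 0 is a
    safe default.\<close>
  define g where "g y = (if N y = {} then 0 else f (w y))" for y
  have "\<exists>g'. (\<forall>y\<in>?Y. g' y < h) \<and> (\<forall>a\<in>?Y. \<forall>b\<in>?Y. a \<noteq> b \<longrightarrow> N a \<inter> N b \<noteq> {} \<longrightarrow> g' a \<noteq> g' b)"
  \<comment> \<open>Branch edges only separate incomparable neighbourhoods, whereas a local
    colouring must also separate nested ones that intersect; recolouring closes this gap.\<close>
  proof (rule recolour_comparable[OF fin h])
    show "g y < h" if "y \<in> ?Y" for y
      using that bv[of y] col h unfolding g_def proper_colouring_def by auto
  next
    fix v a b c assume abc: "a \<in> ?Y" "b \<in> ?Y" "c \<in> ?Y" "v \<in> N a" "v \<in> N b" "v \<in> N c"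
    show "a = b \<or> a = c \<or> b = c"
    proof (rule ccontr)
      assume "\<not> ?thesis"
      then have "card {a, b, c} = 3" by auto
      moreover have "card {a, b, c} \<le> deg_in (Tv v) ET r"
        unfolding deg_in_def using abc finite_Tv[of v] unfolding N_def by (intro card_mono) auto
      ultimately show False using deg2[of v r] abc unfolding N_def by auto
    qed
  next
    fix a b assume ab: "a \<in> ?Y" "b \<in> ?Y" "N a \<inter> N b \<noteq> {}" "\<not> N a \<subseteq> N b" "\<not> N b \<subseteq> N a"
    have "a \<noteq> b" using ab by auto
    then have ne: "w a \<noteq> w b" using tw ab by (metis mem_Collect_eq)
    have "\<not> E (w a) (w b)"
    proof
      assume "E (w a) (w b)"
      then obtain x where x: "x \<in> Tv (w a)" "x \<in> Tv (w b)" using adj w ab ne by blast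
      \<comment> \<open>A common vertex of the two paths would have both \<open>a\<close> and
        \<open>b\<close> as its ancestor at depth 1.\<close>
      have "up x 1 = a" "up x 1 = b"
        using topped_up[OF top x(1)] topped_up[OF top x(2)] w tw ab depth_root_edge by auto
      then show False using \<open>a \<noteq> b\<close> by simp
    qed
    moreover have "\<exists>c\<in>C. E c (w a) \<and> E c (w b)" using ab adjw NC by blast
    moreover have "\<exists>v'\<in>C. \<exists>w'\<in>C. E v' (w a) \<and> \<not> E v' (w b) \<and> E w' (w b) \<and> \<not> E w' (w a)"
    proof -
      obtain v' w' where "v' \<in> N a - N b" "w' \<in> N b - N a" using ab by blast
      then show ?thesis using adjw ab NC by blast
    qed
    moreover have ba: "w a \<in> branch_vertices V E C" "w b \<in> branch_vertices V E C"
      using bv ab by blast+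
    ultimately have "branch_edge V E C (w a) (w b)" unfolding branch_edge_def using ne by blast
    then have "f (w a) \<noteq> f (w b)" using col ba unfolding proper_colouring_def by blast
    then show "g a \<noteq> g b" using ab unfolding g_def by auto
  qed
  then obtain g' where g': "\<And>y. ET r y \<Longrightarrow> g' y < h"
    "\<And>a b. ET r a \<Longrightarrow> ET r b \<Longrightarrow> a \<noteq> b \<Longrightarrow> N a \<inter> N b \<noteq> {} \<Longrightarrow> g' a \<noteq> g' b"
    by blast
  show ?thesis
  proof (rule colourable_atI[of ET r g', OF g'(1)])
    fix y y' v assume e: "ET r y" "ET r y'" "y \<noteq> y'" and v: "v \<in> V" "{r, y, y'} \<subseteq> Tv v"
    then have "v \<in> N y \<inter> N y'" by (auto simp: N_def)
    then show "g' y \<noteq> g' y'" using g'(2)[OF e] by blast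
  qed
qed

lemma colourable_rep_exists:
  fixes VT :: "'b set"
  assumes G: "fsc_graph V E" and h: "h \<ge> 2"
    and chi: "\<And>C. C \<in> cliques V E \<Longrightarrow> chromatic_number (branch_vertices V E C) (branch_edge V E C) \<le> h"
    and rep: "path_rep V E VT ET Tv"
  obtains VT' :: "'b set" and ET' Tv' where "path_rep V E VT' ET' Tv'"
    "\<And>x. x \<in> VT' \<Longrightarrow> colourable_at V ET' Tv' h x"
proof -
  have fin: "finite V" and sim: "simple_graph V E" using G unfolding fsc_graph_def by auto
  define Q where "Q W \<longleftrightarrow> (\<exists>ET Tv. path_rep V E W ET Tv)" for W :: "'b set"
  have "Q VT" using rep unfolding Q_def by blast
  then obtain W where "Q W" and least: "\<And>W'. Q W' \<Longrightarrow> card W \<le> card W'"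
    using ex_has_least_nat[of Q VT card] by blast
  then obtain ET' Tv' where rep': "path_rep V E W ET' Tv'" unfolding Q_def by blast
  have finW: "finite W" using rep' unfolding path_rep_def is_tree_def fsc_graph_def by auto
  have priv: "\<exists>v\<in>V. y \<in> Tv' v \<and> q \<notin> Tv' v" if e: "ET' q y" for q y
  proof (rule ccontr)
    assume no: "\<not> ?thesis"
    have qy: "q \<in> W" "y \<in> W"
      using rep' e unfolding path_rep_def is_tree_def fsc_graph_def simple_graph_def by auto
    obtain p d t where "rooted_rep W ET' q p d V E Tv' t" using rooted_rep_exists[OF fin sim rep' qy(1)] .
    then interpret R: rooted_rep W ET' q p d V E Tv' t .
    \<comment> \<open>If all paths through \<open>y\<close> contained \<open>q\<close>, contracting
      the edge would give a smaller host.\<close>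
    have "Q (W - {y})" unfolding Q_def using R.contract_root_edge[OF e] no by blast
    then have "card W \<le> card (W - {y})" by (rule least)
    then show False using qy finW by (meson card_Diff1_less not_less)
  qed
  have "colourable_at V ET' Tv' h q" if q: "q \<in> W" for q
  proof -
    obtain p d t where "rooted_rep W ET' q p d V E Tv' t" using rooted_rep_exists[OF fin sim rep' q] .
    then interpret R: rooted_rep W ET' q p d V E Tv' t .
    have "{v \<in> V. q \<in> Tv' v} \<in> cliques V E"
      \<comment> \<open>\<open>priv\<close> is used here for the reversed edge: it supplies a path
        through \<open>q\<close> that avoids a given neighbour.\<close>
      using priv R.edge_sym by (intro R.root_clique) blast
    then obtain f where "proper_colouring (branch_vertices V E {v \<in> V. q \<in> Tv' v})
        (branch_edge V E {v \<in> V. q \<in> Tv' v}) f h"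
      using chi chromatic_branch_le_iff[OF fin] by blast
    then show ?thesis using R.root_colourable[OF priv refl h] by blast
  qed
  then show ?thesis using that rep' by blast
qed

section \<open>Splitting vertices of large degree\<close>

text \<open>The edges from \<open>r\<close> to \<open>y1\<close> and \<open>y2\<close> are replaced
  by a new vertex \<open>z\<close> adjacent to all three. Equal colours mean that no path runs from
  \<open>y1\<close> through \<open>r\<close> to \<open>y2\<close>, so every extended path passes
  \<open>z\<close> between \<open>r\<close> and just one of them and remains a path.\<close>

lemma (in rooted_rep) split_root:
  assumes y1: "ET r y1" and y2: "ET r y2" and y12: "y1 \<noteq> y2" and z: "z \<notin> VT" and h: "h \<ge> 3"
    and col: "\<And>x. x \<in> VT \<Longrightarrow> colourable_at V ET Tv h x"
    and g_less: "\<And>y. ET r y \<Longrightarrow> g y < h"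
    and g_diff: "\<And>y y' v. \<lbrakk>ET r y; ET r y'; y \<noteq> y'; v \<in> V; {r, y, y'} \<subseteq> Tv v\<rbrakk> \<Longrightarrow> g y \<noteq> g y'"
    and same: "g y1 = g y2"
  shows "\<exists>ET' Tv'. path_rep V E (insert z VT) ET' Tv' \<and>
    (\<forall>x\<in>insert z VT. colourable_at V ET' Tv' h x) \<and>
    deg_in (insert z VT) ET' z \<le> 3 \<and>
    (\<forall>x\<in>VT. deg_in (insert z VT) ET' x \<le> deg_in VT ET x) \<and>
    deg_in (insert z VT) ET' r < deg_in VT ET r"
proof -
  have yV: "y1 \<in> VT" "y1 \<noteq> r" "p y1 = r" "y2 \<in> VT" "y2 \<noteq> r" "p y2 = r"
    using y1 y2 unfolding edge_root_iff by auto
  have zn: "z \<noteq> r" "z \<noteq> y1" "z \<noteq> y2" using z yV root_in by auto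
  have free: "\<not> (y1 \<in> Tv v \<and> y2 \<in> Tv v)" if "v \<in> V" "r \<in> Tv v" for v
    using g_diff[OF y1 y2 y12] same that by auto
  define p' where "p' x = (if x = z then r else if x = y1 \<or> x = y2 then z else p x)" for x
  \<comment> \<open>Doubling the depths leaves rank 1 free for \<open>z\<close>, between
    \<open>r\<close> at 0 and \<open>y1\<close>, \<open>y2\<close> at 2.\<close>
  define d' where "d' x = (if x = z then 1 else 2 * d x)" for x
  define ET' where "ET' a b \<longleftrightarrow>
      ET a b \<and> \<not> (a = r \<and> b \<in> {y1, y2}) \<and> \<not> (b = r \<and> a \<in> {y1, y2}) \<or>
      a = z \<and> b \<in> {r, y1, y2} \<or> b = z \<and> a \<in> {r, y1, y2}" for a b
  define Tv' where "Tv' v = (if r \<in> Tv v \<and> (y1 \<in> Tv v \<or> y2 \<in> Tv v) then insert z (Tv v) else Tv v)" for v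
  have not_p_z: "p x \<noteq> z" if "x \<in> VT" "x \<noteq> r" for x using parent_in that z by auto
  have not_ET_z: "\<not> ET a z" "\<not> ET z a" for a using z unfolding edge_iff by auto
  interpret N: ranked_tree "insert z VT" ET' r p' d'
  proof
    fix x assume x: "x \<in> insert z VT" "x \<noteq> r"
    show "p' x \<in> insert z VT" using x parent_in root_in unfolding p'_def by auto
    show "d' (p' x) < d' x"
      using x not_p_z[of x] rank_parent[of x] depth_root depth_root_edge[OF y1] depth_root_edge[OF y2] zn
      unfolding p'_def d'_def by auto
  next
    fix a b
    show "ET' a b \<longleftrightarrow> a \<in> insert z VT \<and> b \<in> insert z VT \<and>
        (a \<noteq> r \<and> b = p' a \<or> b \<noteq> r \<and> a = p' b)" (is "_ \<longleftrightarrow> ?rhs")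
    proof (cases "a = z \<or> b = z")
      case True
      then show ?thesis
        using zn yV root_in not_p_z not_ET_z unfolding ET'_def p'_def by auto
    next
      case False
      then show ?thesis
        using zn yV unfolding ET'_def p'_def edge_iff by auto
    qed
  qed (use finite_VT root_in in auto)
  have zTv: "z \<notin> Tv v" if "v \<in> V" for v using Tv_sub[OF that] z by auto
  have Tv'_old: "x \<in> Tv' v \<longleftrightarrow> x \<in> Tv v" if "x \<noteq> z" for x v using that unfolding Tv'_def by auto
  have Tv'_z: "z \<in> Tv' v \<longleftrightarrow> r \<in> Tv v \<and> (y1 \<in> Tv v \<or> y2 \<in> Tv v)" if "v \<in> V" for v
    using zTv[OF that] unfolding Tv'_def by auto
  have nb_r: "ET' r b \<longleftrightarrow> b = z \<or> ET r b \<and> b \<noteq> y1 \<and> b \<noteq> y2" for b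
    using zn yV not_ET_z edge_irrefl unfolding ET'_def by auto
  have nb_z: "ET' z b \<longleftrightarrow> b = r \<or> b = y1 \<or> b = y2" for b
    using zn not_ET_z unfolding ET'_def by auto
  have nb_y: "ET' x b \<longleftrightarrow> b = z \<or> ET x b \<and> b \<noteq> r" if "x = y1 \<or> x = y2" for x b
    using that zn yV not_ET_z unfolding ET'_def by auto
  have nb_other: "ET' x b \<longleftrightarrow> ET x b" if "x \<notin> {z, r, y1, y2}" for x b
    using that unfolding ET'_def by auto
  have topped': "N.topped (Tv' v) (t v)" if v: "v \<in> V" for v
  proof -
    have tp: "Tv v \<subseteq> VT" "t v \<in> Tv v" "\<And>x. x \<in> Tv v \<Longrightarrow> x \<noteq> t v \<Longrightarrow> x \<noteq> r \<and> p x \<in> Tv v"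
      using top[OF v] unfolding topped_def by auto
    have "x \<noteq> r \<and> p' x \<in> Tv' v" if x: "x \<in> Tv' v" "x \<noteq> t v" for x
    proof (cases "x = z")
      case True
      then show ?thesis using x Tv'_z[OF v] zn Tv'_old unfolding p'_def by auto
    next
      case False
      then have px: "x \<noteq> r" "p x \<in> Tv v" "x \<in> Tv v" using tp(3)[of x] x Tv'_old by auto
      moreover have "Tv v \<subseteq> Tv' v" unfolding Tv'_def by auto
      ultimately show ?thesis using Tv'_z[OF v] False yV unfolding p'_def by auto
    qed
    then show ?thesis unfolding N.topped_def using tp(1,2) unfolding Tv'_def by auto
  qed
  \<comment> \<open>General \<open>S\<close> and \<open>S'\<close> cover both the single paths and
    the whole host. At \<open>r\<close> the vertex \<open>z\<close> replaces \<open>y1\<close> or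
    \<open>y2\<close>, at \<open>y1\<close> and \<open>y2\<close> it replaces \<open>r\<close>, and
    elsewhere nothing changes; the last condition on \<open>z\<close> ensures that a replaced
    neighbour lies in \<open>S\<close>.\<close>
  have deg_le: "deg_in S' ET' x \<le> deg_in S ET x"
    if S: "finite S" "x \<in> S" "z \<notin> S" "S' \<subseteq> insert z S" "z \<in> S' \<Longrightarrow> r \<in> S \<and> (y1 \<in> S \<or> y2 \<in> S)"
    for S S' x
  proof -
    let ?B = "{b \<in> S. ET x b}" and ?B' = "{b \<in> S'. ET' x b}"
    have "\<exists>f. ?B' \<subseteq> f ` ?B"
    proof -
      consider "x = r" | "x = y1 \<or> x = y2" | "x \<notin> {z, r, y1, y2}" using S by auto
      then show ?thesis
      proof cases
        case 1
        have "?B' \<subseteq> (\<lambda>b. if b = y1 \<or> b = y2 then z else b) ` ?B"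
        proof
          fix b assume b: "b \<in> ?B'"
          show "b \<in> (\<lambda>b. if b = y1 \<or> b = y2 then z else b) ` ?B"
          proof (cases "b = z")
            case True
            then have "y1 \<in> ?B \<or> y2 \<in> ?B" using b S(5) 1 y1 y2 by auto
            then show ?thesis using True by force
          next
            case False
            then have "b \<in> ?B" "b \<noteq> y1" "b \<noteq> y2" using b 1 nb_r S by auto
            then show ?thesis by force
          qed
        qed
        then show ?thesis by blast
      next
        case 2
        have "?B' \<subseteq> (\<lambda>b. if b = r then z else b) ` ?B"
        proof
          fix b assume b: "b \<in> ?B'"
          show "b \<in> (\<lambda>b. if b = r then z else b) ` ?B"
          proof (cases "b = z")
            case True
            then have "r \<in> ?B" using b S(5) 2 y1 y2 edge_sym by auto
            then show ?thesis using True by force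
          next
            case False
            then have "b \<in> ?B" "b \<noteq> r" using b nb_y[OF 2] S by auto
            then show ?thesis by force
          qed
        qed
        then show ?thesis by blast
      next
        case 3
        then have "?B' \<subseteq> id ` ?B" using nb_other[OF 3] not_ET_z S by auto
        then show ?thesis by blast
      qed
    qed
    then show ?thesis unfolding deg_in_def using S(1) surj_card_le[of ?B ?B'] by auto
  qed
  have deg2': "deg_in (Tv' v) ET' x \<le> 2" if v: "v \<in> V" and x: "x \<in> Tv' v" for v x
  proof (cases "x = z")
    case True
    obtain y where "{b \<in> Tv' v. ET' z b} \<subseteq> {r, y}"
    proof (cases "y1 \<in> Tv v")
      case True
      then have "y2 \<notin> Tv' v" using free[OF v] Tv'_z[OF v] x \<open>x = z\<close> Tv'_old zn by metis
      then show ?thesis using that[of y1] nb_z by auto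
    next
      case False
      then have "y1 \<notin> Tv' v" using Tv'_old zn by metis
      then show ?thesis using that[of y2] nb_z by auto
    qed
    then have "card {b \<in> Tv' v. ET' z b} \<le> card {r, y}" by (intro card_mono) auto
    also have "\<dots> \<le> 2" by (simp add: card_insert_if)
    finally show ?thesis using True unfolding deg_in_def by simp
  next
    case False
    have "deg_in (Tv' v) ET' x \<le> deg_in (Tv v) ET x"
      using False x Tv'_old zTv[OF v] finite_Tv[OF v] Tv'_z[OF v]
      by (intro deg_le) (auto simp: Tv'_def)
    then show ?thesis using deg2[OF v, of x] x Tv'_old[OF False] by auto
  qed
  have "E v w \<longleftrightarrow> Tv' v \<inter> Tv' w \<noteq> {}" if vw: "v \<in> V" "w \<in> V" "v \<noteq> w" for v w
  proof -
    have "Tv v \<inter> Tv w \<noteq> {} \<longleftrightarrow> Tv' v \<inter> Tv' w \<noteq> {}"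
      using zTv vw unfolding Tv'_def by auto
    then show ?thesis using adj[OF vw] by simp
  qed
  then have rep: "path_rep V E (insert z VT) ET' Tv'"
    by (intro N.path_repI[where t = t] topped' deg2')
  have colourable: "colourable_at V ET' Tv' h x" if x: "x \<in> insert z VT" for x
  proof -
    consider "x = z" | "x = r" | "x = y1 \<or> x = y2" | "x \<notin> {z, r, y1, y2}" by auto
    then show ?thesis
    proof cases
      case 1
      show ?thesis
        unfolding 1
        \<comment> \<open>The three neighbours of \<open>z\<close> get three distinct colours, which
          is where \<open>h\<close> has to be at least 3.\<close>
        by (rule colourable_atI[where g = "\<lambda>b. if b = r then 0 else if b = y1 then 1 else 2"])
          (use h nb_z yV y12 in auto)
    next
      case 2
      \<comment> \<open>At \<open>r\<close> the new neighbour \<open>z\<close> inherits the common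
        colour of \<open>y1\<close> and \<open>y2\<close>. A path through \<open>r\<close> and
        \<open>z\<close> contains one of these two, so its other neighbour of \<open>r\<close>
        already had a different colour.\<close>
      have diff: "(g(z := g y1)) y \<noteq> (g(z := g y1)) y'"
        if e: "ET' r y" "ET' r y'" "y \<noteq> y'" and v: "v \<in> V" "{r, y, y'} \<subseteq> Tv' v" for y y' v
      proof -
        have old: "g b \<noteq> g y1" if b: "ET' r b" "b \<noteq> z" "{r, z, b} \<subseteq> Tv' v" for b
        proof -
          have "ET r b" "b \<noteq> y1" "b \<noteq> y2" "b \<in> Tv v" "r \<in> Tv v" "y1 \<in> Tv v \<or> y2 \<in> Tv v"
            using b nb_r Tv'_old Tv'_z[OF v(1)] by auto
          then show ?thesis using g_diff[of b y1 v] g_diff[of b y2 v] y1 y2 same v(1) by auto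
        qed
        show ?thesis
        proof (cases "y = z \<or> y' = z")
          case True
          then show ?thesis using old[of y] old[of y'] e v by auto
        next
          case False
          then have "g y \<noteq> g y'"
            using g_diff[of y y' v] e v nb_r Tv'_old zn by auto
          then show ?thesis using False by simp
        qed
      qed
      have less: "(g(z := g y1)) y < h" if "ET' r y" for y
        using that nb_r g_less y1 by auto
      show ?thesis unfolding 2 by (rule colourable_atI[OF less diff])
    next
      case 3
      then have "x \<in> VT" and xr: "ET x r" and xn: "x \<noteq> z" using yV zn y1 y2 edge_sym by auto
      then obtain f where f: "\<And>y. ET x y \<Longrightarrow> f y < h"
        "\<And>y y' v. \<lbrakk>ET x y; ET x y'; y \<noteq> y'; v \<in> V; {x, y, y'} \<subseteq> Tv v\<rbrakk> \<Longrightarrow> f y \<noteq> f y'"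
        using colourable_atE[OF col] by metis
      \<comment> \<open>Seen from \<open>y1\<close> or \<open>y2\<close>, the vertex
        \<open>z\<close> takes over the place and the colour of \<open>r\<close>.\<close>
      let ?f = "\<lambda>b. f (if b = z then r else b)"
      have diff: "?f y \<noteq> ?f y'"
        if e: "ET' x y" "ET' x y'" "y \<noteq> y'" and v: "v \<in> V" "{x, y, y'} \<subseteq> Tv' v" for y y' v
      proof (rule f(2)[OF _ _ _ v(1)])
        show "ET x (if y = z then r else y)" "ET x (if y' = z then r else y')"
          "(if y = z then r else y) \<noteq> (if y' = z then r else y')"
          using e nb_y[OF 3] xr by auto
        show "{x, if y = z then r else y, if y' = z then r else y'} \<subseteq> Tv v"
          using v Tv'_old Tv'_z[OF v(1)] xn by auto
      qed
      have less: "?f y < h" if "ET' x y" for y using that nb_y[OF 3] f(1) xr by auto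
      show ?thesis by (rule colourable_atI[of ET' x ?f, OF less diff])
    next
      case 4
      then have "x \<in> VT" using x by auto
      then obtain f where f: "\<And>y. ET x y \<Longrightarrow> f y < h"
        "\<And>y y' v. \<lbrakk>ET x y; ET x y'; y \<noteq> y'; v \<in> V; {x, y, y'} \<subseteq> Tv v\<rbrakk> \<Longrightarrow> f y \<noteq> f y'"
        using colourable_atE[OF col] by metis
      show ?thesis
      proof (rule colourable_atI[of ET' x f])
        show "f y < h" if "ET' x y" for y using that f(1) nb_other[OF 4] by simp
        fix y y' v assume e: "ET' x y" "ET' x y'" "y \<noteq> y'" and v: "v \<in> V" "{x, y, y'} \<subseteq> Tv' v"
        then have "ET x y" "ET x y'" "x \<noteq> z" "y \<noteq> z" "y' \<noteq> z" using nb_other[OF 4] 4 not_ET_z by auto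
        then show "f y \<noteq> f y'" using f(2)[OF _ _ e(3) v(1)] v(2) Tv'_old by simp
      qed
    qed
  qed
  have dz: "deg_in (insert z VT) ET' z \<le> 3"
  proof -
    have "card {b \<in> insert z VT. ET' z b} \<le> card {r, y1, y2}" using nb_z by (intro card_mono) auto
    also have "\<dots> \<le> 3" by (simp add: card_insert_if)
    finally show ?thesis unfolding deg_in_def .
  qed
  have dx: "deg_in (insert z VT) ET' x \<le> deg_in VT ET x" if "x \<in> VT" for x
    using that finite_VT z root_in yV by (intro deg_le) auto
  have dr: "deg_in (insert z VT) ET' r < deg_in VT ET r"
  proof -
    let ?B = "{b \<in> VT. ET r b}"
    have fin: "finite ?B" using finite_VT by simp
    \<comment> \<open>Two neighbours leave and one arrives, so the degree of \<open>r\<close> falls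
      by one.\<close>
    have "{b \<in> insert z VT. ET' r b} = insert z (?B - {y1, y2})" using nb_r not_ET_z by auto
    then have "deg_in (insert z VT) ET' r \<le> Suc (card (?B - {y1, y2}))"
      unfolding deg_in_def using fin by (simp add: card_insert_if)
    moreover have sub: "{y1, y2} \<subseteq> ?B" using y1 y2 yV by auto
    then have "card (?B - {y1, y2}) = card ?B - 2" using y12 by (simp add: card_Diff_subset)
    moreover have "card {y1, y2} \<le> card ?B" using fin sub by (rule card_mono)
    ultimately show ?thesis using y12 unfolding deg_in_def by simp
  qed
  show ?thesis
    by (intro exI[of _ ET'] exI[of _ Tv'] conjI ballI rep colourable dz dx dr)
qed

lemma bounded_rep_exists:
  fixes VT :: "nat set"
  assumes G: "fsc_graph V E" and h: "h \<ge> 3"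
    and "path_rep V E VT ET Tv" "\<And>x. x \<in> VT \<Longrightarrow> colourable_at V ET Tv h x"
  shows "\<exists>(VT :: nat set) ET Tv. path_rep V E VT ET Tv \<and> (\<forall>x\<in>VT. deg_in VT ET x \<le> h)"
  using assms(3,4)
\<comment> \<open>The measure is the total excess of degrees over \<open>h\<close>. Truncated
  subtraction makes vertices of degree at most \<open>h\<close> count 0, in particular each new
  vertex, whose degree is at most 3.\<close>
proof (induction "\<Sum>x\<in>VT. deg_in VT ET x - h" arbitrary: VT ET Tv rule: less_induct)
  case less
  note rep = less.prems(1) and col = less.prems(2)
  have fin: "finite V" and sim: "simple_graph V E" using G unfolding fsc_graph_def by auto
  show ?case
  proof (cases "\<forall>x\<in>VT. deg_in VT ET x \<le> h")
    case True
    then show ?thesis using rep by blast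
  next
    case False
    then obtain q where q: "q \<in> VT" "deg_in VT ET q > h" by auto
    obtain p d t where "rooted_rep VT ET q p d V E Tv t" using rooted_rep_exists[OF fin sim rep q(1)] .
    then interpret R: rooted_rep VT ET q p d V E Tv t .
    obtain g where g: "\<And>y. ET q y \<Longrightarrow> g y < h"
      "\<And>y y' v. \<lbrakk>ET q y; ET q y'; y \<noteq> y'; v \<in> V; {q, y, y'} \<subseteq> Tv v\<rbrakk> \<Longrightarrow> g y \<noteq> g y'"
      using colourable_atE[OF col[OF q(1)]] by metis
    \<comment> \<open>Pigeonhole: more than \<open>h\<close> neighbours share \<open>h\<close>
      colours.\<close>
    have "\<not> inj_on g {y \<in> VT. ET q y}"
    proof
      assume "inj_on g {y \<in> VT. ET q y}"
      then have "card {y \<in> VT. ET q y} \<le> card {..<h}"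
        using g(1) by (intro card_inj_on_le[where f = g]) auto
      then show False using q(2) unfolding deg_in_def by simp
    qed
    then obtain y1 y2 where y: "ET q y1" "ET q y2" "y1 \<noteq> y2" "g y1 = g y2"
      unfolding inj_on_def by auto
    obtain z where z: "z \<notin> VT" using ex_new_if_finite[OF infinite_UNIV_nat R.finite_VT] by blast
    have "\<exists>ET' Tv'. path_rep V E (insert z VT) ET' Tv' \<and>
      (\<forall>x\<in>insert z VT. colourable_at V ET' Tv' h x) \<and>
      deg_in (insert z VT) ET' z \<le> 3 \<and>
      (\<forall>x\<in>VT. deg_in (insert z VT) ET' x \<le> deg_in VT ET x) \<and>
      deg_in (insert z VT) ET' q < deg_in VT ET q"
      by (rule R.split_root[OF y(1-3) z h col g(1) g(2) y(4)])
    then obtain ET' Tv' where s: "path_rep V E (insert z VT) ET' Tv'"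
      "\<forall>x\<in>insert z VT. colourable_at V ET' Tv' h x"
      and dz: "deg_in (insert z VT) ET' z \<le> 3"
      and dx: "\<forall>x\<in>VT. deg_in (insert z VT) ET' x \<le> deg_in VT ET x"
      and dq: "deg_in (insert z VT) ET' q < deg_in VT ET q"
      by (elim exE conjE)
    have "(\<Sum>x\<in>insert z VT. deg_in (insert z VT) ET' x - h) =
        (\<Sum>x\<in>VT. deg_in (insert z VT) ET' x - h)"
      using z R.finite_VT dz h by simp
    also have "\<dots> < (\<Sum>x\<in>VT. deg_in VT ET x - h)"
    proof (rule sum_strict_mono_ex1[OF R.finite_VT])
      show "\<forall>x\<in>VT. deg_in (insert z VT) ET' x - h \<le> deg_in VT ET x - h"
        using dx by (auto intro: diff_le_mono)
      show "\<exists>x\<in>VT. deg_in (insert z VT) ET' x - h < deg_in VT ET x - h"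
        using q dq by (intro bexI[of _ q]) auto
    qed
    finally show ?thesis using less.hyps s by blast
  qed
qed

section \<open>The class criterion and the theorem\<close>

lemma in_class_iff_chromatic_le:
  assumes G: "fsc_graph V E" and vpt: "VPT V E" and h: "h \<ge> 3"
  shows "in_class V E (enat h) 2 1 \<longleftrightarrow>
    (\<forall>C\<in>cliques V E. chromatic_number (branch_vertices V E C) (branch_edge V E C) \<le> h)"
    (is "?l \<longleftrightarrow> ?r")
proof
  assume ?l
  then show ?r using in_class_chromatic_le[OF G] by blast
next
  assume chi: ?r
  obtain VT :: "nat set" and ET Tv where rep: "path_rep V E VT ET Tv"
    using vpt unfolding VPT_def in_class_iff by blast
  have "h \<ge> 2" using h by simp
  then obtain VT' :: "nat set" and ET' Tv' where "path_rep V E VT' ET' Tv'"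
    "\<And>x. x \<in> VT' \<Longrightarrow> colourable_at V ET' Tv' h x"
    using colourable_rep_exists[OF G _ _ rep] chi by blast
  then obtain VT2 :: "nat set" and ET2 Tv2 where
    "path_rep V E VT2 ET2 Tv2" "\<forall>x\<in>VT2. deg_in VT2 ET2 x \<le> h"
    using bounded_rep_exists[OF G h] by blast
  then show ?l unfolding in_class_iff max_deg_le_def by auto
qed

lemma max_branch_chi_le_iff:
  assumes "fsc_graph V E"
  shows "max_branch_chi V E \<le> h \<longleftrightarrow>
    (\<forall>C\<in>cliques V E. chromatic_number (branch_vertices V E C) (branch_edge V E C) \<le> h)"
  unfolding max_branch_chi_def using cliques_finite_nonempty[OF assms] by (subst Max_le_iff) auto

theorem mainTheorem5:
  fixes V :: "'a set" and E :: "'a \<Rightarrow> 'a \<Rightarrow> bool"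
  assumes "fsc_graph V E"
    and "VPT V E"
  shows "(\<forall>h::nat. h \<ge> 4 \<longrightarrow>
            ((in_class V E (enat h) 2 1 \<and> \<not> in_class V E (enat (h - 1)) 2 1)
               \<longleftrightarrow> max_branch_chi V E = h))
         \<and> (max_branch_chi V E = 3 \<longrightarrow>
              in_class V E 3 2 1 \<and> \<not> in_class V E 2 2 1)"
proof (intro conjI allI impI)
  have iff: "in_class V E (enat h) 2 1 \<longleftrightarrow> max_branch_chi V E \<le> h" if "h \<ge> 3" for h
    using in_class_iff_chromatic_le[OF assms that] max_branch_chi_le_iff[OF assms(1)] by simp
  show "in_class V E (enat h) 2 1 \<and> \<not> in_class V E (enat (h - 1)) 2 1 \<longleftrightarrow> max_branch_chi V E = h"
    if "h \<ge> 4" for h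
    \<comment> \<open>The criterion is applied at \<open>h - 1\<close> as well, which is why
      \<open>h\<close> must be at least 4.\<close>
    using that iff[of h] iff[of "h - 1"] by auto
  assume 3: "max_branch_chi V E = 3"
  then show "in_class V E 3 2 1" using iff[of 3] by (simp add: numeral_eq_enat)
  \<comment> \<open>The value 2 lies below the range of \<open>iff\<close>, but the necessity
    direction holds for every \<open>h\<close> and suffices here.\<close>
  have "max_branch_chi V E \<le> 2" if "in_class V E 2 2 1"
    using in_class_chromatic_le[OF assms(1), of 2] that max_branch_chi_le_iff[OF assms(1)]
    by (simp add: numeral_eq_enat)
  then show "\<not> in_class V E 2 2 1" using 3 by auto
qed

end
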